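(* Let $c=\|P\|\,\|P^{-1}\|\,(1+\|F\|)$ and $H=B(R+B^\top PB)^{-1}B^\top$. Suppose there are $d\ge 0$ steps of feedback delay and the controller runs the myopic predictive policy (defined in the context) using $k\ge 0$ predictions, whose errors satisfy the relative error bounds with parameters $\epsilon_i$. Let $\mathrm{Alg}$ be the cost of this policy and $\mathrm{Opt}$ the cost of the optimal offline policy. Then, for every admissible choice of disturbances and predictions: (a) when $k\ge d$, $$\mathrm{Alg}\le\left[\frac{\left(c\sum_{i=0}^{d-1}\epsilon_i\|A^{d-i}\|+c\sum_{i=d}^{k-1}\epsilon_i\|F^{i-d}\|+\|F^{k-d}\|\right)^2}{\|H\|^{-1}\,\lambda_{\min}(P^{-1}-FP^{-1}F^\top-H)}+1\right]\mathrm{Opt}+O(1);$$ (b) when $k\le d$, $$\mathrm{Alg}\le\left[\frac{\left(c\sum_{i=0}^{k-1}\epsilon_i\|A^{d-i}\|+c\sum_{i=k}^{d-1}\|A^{d-i}\|+1\right)^2}{\|H\|^{-1}\,\lambda_{\min}(P^{-1}-FP^{-1}F^\top-H)}+1\right]\mathrm{Opt}+O(1).$$ Here $O(1)$ is with respect to $T$: it denotes a quantity bounded by a constant that may depend on the system parameters $A,B,Q,R,Q_f$ (and the other fixed data of the problem) and on the bound $r$ on the disturbances, but not on $T$. When $Q_f=P$, the $O(1)$ term is zero.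
   Context: Notation: $\|\cdot\|$ is the Euclidean norm of a vector or the spectral norm of a matrix, $\rho(\cdot)$ the spectral radius, $\lambda_{\min}$ the smallest eigenvalue of a symmetric matrix. System: $x_{t+1}=Ax_t+Bu_t+w_t$ for $t=0,\dots,T-1$, with given $x_0\in\mathbb{R}^n$, states $x_t\in\mathbb{R}^n$, controls $u_t\in\mathbb{R}^m$, and disturbances $\|w_t\|\le r$ chosen adversarially and adaptively. Cost: $J=\sum_{t=0}^{T-1}(x_t^\top Qx_t+u_t^\top Ru_t)+x_T^\top Q_fx_T$. Assumptions: $Q,Q_f\succeq0$, $R\succ0$ symmetric; $(A,B)$ is stabilizable (there is $K_0$ with $\rho(A-BK_0)<1$); $(A^\top,Q)$ is stabilizable. $P$ is the (unique positive semidefinite) solution of the discrete algebraic Riccati equation $P=Q+A^\top PA-A^\top PB(R+B^\top PB)^{-1}B^\top PA$, and $F=A-B(R+B^\top PB)^{-1}B^\top PA$ (which satisfies $\rho(F)<1$). It is understood that $P$ is invertible and $\lambda_{\min}(P^{-1}-FP^{-1}F^\top-H)>0$, so that the bounds are meaningful. Information: with delay $d$, at step $t$ the controller knows $x_0,u_0,\dots,u_{t-1},w_0,\dots,w_{t-d-1}$ (equivalently, states up to $x_{t-d}$) and predictions $\hat w_{s|t}$ of $w_s$ for $s=t-d,\dots,T-1$. The errors $e_{s|t}=w_s-\hat w_{s|t}$ satisfy $\|e_{t-d+i|t}\|\le\epsilon_i\|w_{t-d+i}\|$ for all $i\ge0$, $t\ge0$, with given $\epsilon_i\ge 0$. Disturbances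 and predictions with time index $s<0$ or $s\ge T$ are regarded as zero. Myopic predictive policy with $k$ predictions: at time $t$ it uses only $\hat w_{s|t}$ for $t-d\le s\le t-d+k-1$. State estimates: $\hat x_{s_0|t}=x_{s_0}$ for $s_0=\max(t-d,0)$, and $\hat x_{s+1|t}=A\hat x_{s|t}+Bu_s+\tilde w_s$ for $s_0\le s\le t-1$, where $\tilde w_s=\hat w_{s|t}$ if $s\le t-d+k-1$ and $\tilde w_s=0$ otherwise. If $k\ge d$: $u_t=-(R+B^\top PB)^{-1}B^\top\left(PA\hat x_{t|t}+\sum_{i=0}^{k-d-1}(F^\top)^iP\hat w_{t+i|t}\right)$. If $k\le d$: $u_t=-(R+B^\top PB)^{-1}B^\top PA\,\hat x_{t|t}$, where (for $t\ge d$) $\hat x_{t|t}=A^{d-k}\hat x_{t-d+k|t}+\sum_{i=0}^{d-k-1}A^iBu_{t-1-i}$. The two cases coincide for $k=d$. $\mathrm{Alg}$ is the cost $J$ of this policy; $\mathrm{Opt}$ is the minimum of $J$ over all control sequences given full knowledge of $w_0,\dots,w_{T-1}$. *)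

theory Defs
  imports "HOL-Analysis.Analysis"
begin

section \<open>Matrices\<close>

(* On vec types the library operations * and ^ are componentwise, and norm on a matrix is the
   Frobenius norm; hence the following two definitions. *)

primrec matpow :: "'a::semiring_1^'n^'n \<Rightarrow> nat \<Rightarrow> 'a^'n^'n" where
  "matpow M 0 = mat 1"
| "matpow M (Suc i) = M ** matpow M i"

definition spec_norm :: "real^'n^'m \<Rightarrow> real" where
  "spec_norm M = onorm (\<lambda>v. M *v v)"

definition eigenvalue :: "'a::field^'n^'n \<Rightarrow> 'a \<Rightarrow> bool" where
  "eigenvalue M l \<longleftrightarrow> (\<exists>v. v \<noteq> 0 \<and> M *v v = l *s v)"

(* Complex eigenvalues of a real matrix; they form a finite nonempty set, so the supremum is a
   maximum. *)
definition spec_radius :: "real^'n^'n \<Rightarrow> real" where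
  "spec_radius M = Sup {cmod l | l. eigenvalue (map_matrix complex_of_real M) l}"

(* Only meant for symmetric M. *)
definition lambda_min :: "real^'n^'n \<Rightarrow> real" where
  "lambda_min M = (LEAST l. eigenvalue M l)"

definition psd :: "real^'n^'n \<Rightarrow> bool" where
  "psd M \<longleftrightarrow> transpose M = M \<and> (\<forall>v. 0 \<le> v \<bullet> (M *v v))"

definition pos_def :: "real^'n^'n \<Rightarrow> bool" where
  "pos_def M \<longleftrightarrow> transpose M = M \<and> (\<forall>v. v \<noteq> 0 \<longrightarrow> 0 < v \<bullet> (M *v v))"

definition stabilizable :: "real^'n^'n \<Rightarrow> real^'m^'n \<Rightarrow> bool" where
  "stabilizable A B \<longleftrightarrow> (\<exists>K::real^'n^'m. spec_radius (A - B ** K) < 1)"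

section \<open>The linear quadratic control problem\<close>

(* The matrix (R + B^T P B)^{-1} B^T. Its product with B is H. *)
definition gain :: "real^'m^'n \<Rightarrow> real^'m^'m \<Rightarrow> real^'n^'n \<Rightarrow> real^'n^'m" where
  "gain B R P = matrix_inv (R + transpose B ** P ** B) ** transpose B"

definition riccati_solution ::
  "real^'n^'n \<Rightarrow> real^'m^'n \<Rightarrow> real^'n^'n \<Rightarrow> real^'m^'m \<Rightarrow> real^'n^'n \<Rightarrow> bool" where
  "riccati_solution A B Q R P \<longleftrightarrow>
     P = Q + transpose A ** P ** A - transpose A ** P ** B ** gain B R P ** P ** A"

definition closed_loop ::
  "real^'n^'n \<Rightarrow> real^'m^'n \<Rightarrow> real^'m^'m \<Rightarrow> real^'n^'n \<Rightarrow> real^'n^'n" where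
  "closed_loop A B R P = A - B ** gain B R P ** P ** A"

(* Disturbances are indexed by integers, because with delay d the time index t - d may be
   negative. *)
primrec state ::
  "real^'n^'n \<Rightarrow> real^'m^'n \<Rightarrow> real^'n \<Rightarrow> (int \<Rightarrow> real^'n) \<Rightarrow> (nat \<Rightarrow> real^'m) \<Rightarrow> nat \<Rightarrow> real^'n" where
  "state A B x0 w u 0 = x0"
| "state A B x0 w u (Suc t) = A *v state A B x0 w u t + B *v u t + w (int t)"

definition cost ::
  "real^'n^'n \<Rightarrow> real^'m^'n \<Rightarrow> real^'n^'n \<Rightarrow> real^'m^'m \<Rightarrow> real^'n^'n \<Rightarrow> real^'n \<Rightarrow> nat
    \<Rightarrow> (int \<Rightarrow> real^'n) \<Rightarrow> (nat \<Rightarrow> real^'m) \<Rightarrow> real" where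
  "cost A B Q R Qf x0 T w u =
     (let x = state A B x0 w u in
       (\<Sum>t<T. x t \<bullet> (Q *v x t) + u t \<bullet> (R *v u t)) + x T \<bullet> (Qf *v x T))"

(* The infimum is attained when Q and Qf are positive semidefinite and R is positive definite. *)
definition Opt ::
  "real^'n^'n \<Rightarrow> real^'m^'n \<Rightarrow> real^'n^'n \<Rightarrow> real^'m^'m \<Rightarrow> real^'n^'n \<Rightarrow> real^'n \<Rightarrow> nat
    \<Rightarrow> (int \<Rightarrow> real^'n) \<Rightarrow> real" where
  "Opt A B Q R Qf x0 T w = (INF u. cost A B Q R Qf x0 T w u)"

section \<open>Delayed feedback and imperfect predictions\<close>

(* what s t is the prediction of w s available at time t. *)
definition admissible ::
  "real \<Rightarrow> (nat \<Rightarrow> real) \<Rightarrow> nat \<Rightarrow> nat \<Rightarrow> (int \<Rightarrow> real^'n) \<Rightarrow> (int \<Rightarrow> nat \<Rightarrow> real^'n) \<Rightarrow> bool" where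
  "admissible r \<epsilon> d T w what \<longleftrightarrow>
     (\<forall>s. 0 \<le> s \<and> s < int T \<longrightarrow> norm (w s) \<le> r) \<and>
     (\<forall>s. s < 0 \<or> int T \<le> s \<longrightarrow> w s = 0 \<and> (\<forall>t. what s t = 0)) \<and>
     (\<forall>i t. norm (w (int t - int d + int i) - what (int t - int d + int i) t)
              \<le> \<epsilon> i * norm (w (int t - int d + int i)))"

(* The estimate of x_{s0+j} formed at time t, where s0 = max (t - d) 0 is the truncated difference
   t - d of natural numbers; x is the true trajectory, of which only x s0 is used, and u the
   control sequence, of which only the values at s0, ..., s0+j-1 are used. *)
primrec state_estimate ::
  "real^'n^'n \<Rightarrow> real^'m^'n \<Rightarrow> nat \<Rightarrow> nat \<Rightarrow> (int \<Rightarrow> nat \<Rightarrow> real^'n) \<Rightarrow> (nat \<Rightarrow> real^'n)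
    \<Rightarrow> (nat \<Rightarrow> real^'m) \<Rightarrow> nat \<Rightarrow> nat \<Rightarrow> real^'n" where
  "state_estimate A B d k what x u t 0 = x (t - d)"
| "state_estimate A B d k what x u t (Suc j) =
     (let s = t - d + j in
       A *v state_estimate A B d k what x u t j + B *v u s +
       (if int s \<le> int t - int d + int k - 1 then what (int s) t else 0))"

(* The control of the myopic predictive policy at time t, given the earlier controls u; the values
   of u from time t on are not used. The step count t - (t - d) = min d t leads from s0 to t. *)
definition myopic_control ::
  "real^'n^'n \<Rightarrow> real^'m^'n \<Rightarrow> real^'m^'m \<Rightarrow> real^'n^'n \<Rightarrow> real^'n \<Rightarrow> nat \<Rightarrow> nat
    \<Rightarrow> (int \<Rightarrow> real^'n) \<Rightarrow> (int \<Rightarrow> nat \<Rightarrow> real^'n) \<Rightarrow> (nat \<Rightarrow> real^'m) \<Rightarrow> nat \<Rightarrow> real^'m" where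
  "myopic_control A B R P x0 d k w what u t =
     (let xhat = state_estimate A B d k what (state A B x0 w u) u t (t - (t - d));
          F = closed_loop A B R P
      in if d \<le> k
         then - (gain B R P *v
                  (P *v (A *v xhat) +
                   (\<Sum>i<k-d. matpow (transpose F) i *v (P *v what (int t + int i) t))))
         else - (gain B R P *v (P *v (A *v xhat))))"

(* The policy's controls at times below t, padded with zeros. *)
primrec myopic_history ::
  "real^'n^'n \<Rightarrow> real^'m^'n \<Rightarrow> real^'m^'m \<Rightarrow> real^'n^'n \<Rightarrow> real^'n \<Rightarrow> nat \<Rightarrow> nat
    \<Rightarrow> (int \<Rightarrow> real^'n) \<Rightarrow> (int \<Rightarrow> nat \<Rightarrow> real^'n) \<Rightarrow> nat \<Rightarrow> nat \<Rightarrow> real^'m" where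
  "myopic_history A B R P x0 d k w what 0 = (\<lambda>_. 0)"
| "myopic_history A B R P x0 d k w what (Suc t) =
     (let u = myopic_history A B R P x0 d k w what t in
       u(t := myopic_control A B R P x0 d k w what u t))"

definition myopic_policy ::
  "real^'n^'n \<Rightarrow> real^'m^'n \<Rightarrow> real^'m^'m \<Rightarrow> real^'n^'n \<Rightarrow> real^'n \<Rightarrow> nat \<Rightarrow> nat
    \<Rightarrow> (int \<Rightarrow> real^'n) \<Rightarrow> (int \<Rightarrow> nat \<Rightarrow> real^'n) \<Rightarrow> nat \<Rightarrow> real^'m" where
  "myopic_policy A B R P x0 d k w what t = myopic_history A B R P x0 d k w what (Suc t) t"

definition Alg ::
  "real^'n^'n \<Rightarrow> real^'m^'n \<Rightarrow> real^'n^'n \<Rightarrow> real^'m^'m \<Rightarrow> real^'n^'n \<Rightarrow> real^'n^'n \<Rightarrow> real^'n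
    \<Rightarrow> nat \<Rightarrow> nat \<Rightarrow> nat \<Rightarrow> (int \<Rightarrow> real^'n) \<Rightarrow> (int \<Rightarrow> nat \<Rightarrow> real^'n) \<Rightarrow> real" where
  "Alg A B Q R Qf P x0 d k T w what =
     cost A B Q R Qf x0 T w (myopic_policy A B R P x0 d k w what)"

lemma state_cong:
  "(\<And>s. s < t \<Longrightarrow> u s = u' s) \<Longrightarrow> state A B x0 w u t = state A B x0 w u' t"
  by (induction t) auto

lemma state_estimate_cong:
  assumes "\<And>s. s < t - d + j \<Longrightarrow> u s = u' s" and "x (t - d) = x' (t - d)"
  shows "state_estimate A B d k what x u t j = state_estimate A B d k what x' u' t j"
  using assms by (induction j) (auto simp: Let_def)

lemma myopic_control_cong:
  assumes "\<And>s. s < t \<Longrightarrow> u s = u' s"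
  shows "myopic_control A B R P x0 d k w what u t = myopic_control A B R P x0 d k w what u' t"
proof -
  have "state A B x0 w u (t - d) = state A B x0 w u' (t - d)"
    by (rule state_cong) (use assms in auto)
  then have "state_estimate A B d k what (state A B x0 w u) u t (t - (t - d))
      = state_estimate A B d k what (state A B x0 w u') u' t (t - (t - d))"
    by (intro state_estimate_cong) (use assms in auto)
  then show ?thesis
    by (simp add: myopic_control_def Let_def)
qed

lemma myopic_history_eq:
  "s < t \<Longrightarrow> myopic_history A B R P x0 d k w what t s = myopic_policy A B R P x0 d k w what s"
proof (induction t)
  case (Suc t)
  then show ?case
    by (cases "s = t") (auto simp: myopic_policy_def Let_def)
qed simp

(* The policy is the sequence that satisfies the defining equation of the controls at every
   time. *)
lemma myopic_policy_eq:
  "myopic_policy A B R P x0 d k w what t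
     = myopic_control A B R P x0 d k w what (myopic_policy A B R P x0 d k w what) t"
proof -
  have "myopic_policy A B R P x0 d k w what t
      = myopic_control A B R P x0 d k w what (myopic_history A B R P x0 d k w what t) t"
    by (simp add: myopic_policy_def Let_def)
  also have "\<dots> = myopic_control A B R P x0 d k w what (myopic_policy A B R P x0 d k w what) t"
    by (rule myopic_control_cong) (rule myopic_history_eq)
  finally show ?thesis .
qed

end

theory Submission
  imports Defs
begin

text \<open>
Write \<open>W = R + B\<^sup>T P B\<close>, \<open>G = inverse(W) B\<^sup>T\<close>, \<open>S = inverse(P)\<close>, \<open>M = S - F S F\<^sup>T - H\<close>
and \<open>l = lambda_min M\<close>, and let \<open>\<psi>\<^sub>t = \<Sum>\<^sub>i (F\<^sup>T)\<^sup>i P w\<^sub>t\<^sub>+\<^sub>i\<close>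
be the sum of the disturbances still to come, propagated backwards by the closed loop
(\<open>tail\<close>). It satisfies
\<open>\<psi>\<^sub>t = P w\<^sub>t + F\<^sup>T \<psi>\<^sub>t\<^sub>+\<^sub>1\<close> and vanishes from time \<open>T\<close> on.

Suppose first that the terminal weight is \<open>P\<close>. The optimal control given full knowledge of the
disturbances is \<open>-G (P A x\<^sub>t + \<psi>\<^sub>t)\<close>, and completing the square in every step
(\<open>bellman_identity\<close>) splits the cost of arbitrary controls as
  \<open>J = V\<^sub>0 + \<Sum>\<^sub>t \<psi>\<^sub>t \<bullet> M \<psi>\<^sub>t + \<Sum>\<^sub>t z\<^sub>t \<bullet> W z\<^sub>t\<close>,
where \<open>z\<^sub>t\<close> is the deviation of \<open>u\<^sub>t\<close> from that control and \<open>V\<^sub>0 \<ge> 0\<close>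
(\<open>cost_eq_offline_cost\<close>). The first two terms are the optimal cost, which is therefore at least
\<open>l \<Sum>\<^sub>t \<parallel>\<psi>\<^sub>t\<parallel>\<^sup>2\<close>.

The deviation of the myopic policy is \<open>G \<eta>\<^sub>t\<close>, where \<open>\<eta>\<^sub>t\<close> collects what the policy does not
know: the error of the state estimate, the errors of the predictions, and the part of \<open>\<psi>\<^sub>t\<close>
beyond the prediction window (\<open>myopic_deviation\<close>). Each contribution is bounded by some
\<open>\<parallel>w\<^sub>s\<parallel>\<close> or by some \<open>\<parallel>\<psi>\<^sub>s\<parallel>\<close>. As \<open>w\<^sub>t = S (\<psi>\<^sub>t - F\<^sup>T \<psi>\<^sub>t\<^sub>+\<^sub>1)\<close>, Minkowski's
inequality bounds the square sum of \<open>\<eta>\<close> by a constant times the square sum of \<open>\<psi>\<close>, hence by a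
multiple of the optimal cost (\<open>cost_le_offline_cost\<close>). Multiplication by \<open>\<parallel>H\<parallel>\<close> accounts for
\<open>z\<^sub>t \<bullet> W z\<^sub>t = \<eta>\<^sub>t \<bullet> H \<eta>\<^sub>t\<close>.

Now let \<open>Q\<^sub>f\<close> be arbitrary. Replacing \<open>P\<close> by \<open>Q\<^sub>f\<close> changes the cost of the policy only through its
final state, which is bounded uniformly in \<open>T\<close>: positivity of \<open>l\<close> makes \<open>F\<^sup>T\<close> a strict
contraction for the quadratic form of \<open>S\<close>, so the powers of \<open>F\<close> are summable
(\<open>F_powers_summable\<close>). For the optimal cost the comparison is with controls whose final state may
be large. Such a state is the sum of a bounded state and a displacement \<open>e\<close> caused by the
deviations, and producing \<open>e\<close> costs at least \<open>e \<bullet> P e + l \<parallel>P e\<parallel>\<^sup>2\<close>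
(\<open>reachability_energy\<close>). This outweighs the terminal cost \<open>e \<bullet> P e\<close> that is saved, with a quadratic
surplus that absorbs the cross terms (\<open>offline_cost_le_cost\<close>).
\<close>

section \<open>Matrices\<close>

(* This simp rule turns transpose M *v x into x v* M, which the rules below do not match. *)
declare transpose_matrix_vector [simp del]

text \<open>Transposes in products of matrices will always be moved to the other side of an
inner product, which keeps the calculations at the level of vectors.\<close>

lemma inner_transpose_left: "(transpose M *v x) \<bullet> y = x \<bullet> (M *v y)"
  for M :: "real^'n^'m"
  by (simp add: transpose_matrix_vector dot_lmul_matrix)

lemma inner_transpose_right: "x \<bullet> (transpose M *v y) = (M *v x) \<bullet> y"
  for M :: "real^'n^'m"
  by (metis inner_commute inner_transpose_left)

lemma matrix_vector_mult_sum: "M *v (\<Sum>i\<in>I. f i) = (\<Sum>i\<in>I. M *v f i)"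
  for M :: "real^'n^'m"
  by (induction I rule: infinite_finite_induct) (auto simp: matrix_vector_right_distrib)

lemma matpow_Suc_right: "matpow M (Suc i) = matpow M i ** M"
  by (induction i) (simp_all add: matrix_mul_assoc)

lemma transpose_matpow: "matpow (transpose M) i = transpose (matpow M i)"
  for M :: "real^'n^'n"
proof (induction i)
  case (Suc i)
  have "transpose (matpow M (Suc i)) = transpose M ** transpose (matpow M i)"
    unfolding matpow_Suc_right by (rule matrix_transpose_mul)
  with Suc show ?case by simp
qed simp

lemma norm_matrix_vector_le: "norm (M *v x) \<le> spec_norm M * norm x"
  unfolding spec_norm_def by (rule onorm) simp

lemma spec_norm_nonneg: "0 \<le> spec_norm M"
  unfolding spec_norm_def by (rule onorm_pos_le) simp

lemma spec_norm_leI: "(\<And>x. norm (M *v x) \<le> b * norm x) \<Longrightarrow> spec_norm M \<le> b"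
  unfolding spec_norm_def by (rule onorm_le)

lemma spec_norm_transpose_le: "spec_norm (transpose M) \<le> spec_norm M"
  for M :: "real^'n^'m"
proof (rule spec_norm_leI)
  fix x
  let ?y = "transpose M *v x"
  have "norm ?y * norm ?y = x \<bullet> (M *v ?y)"
    by (metis inner_transpose_left power2_eq_square power2_norm_eq_inner)
  also have "\<dots> \<le> norm x * (spec_norm M * norm ?y)"
    by (intro order_trans[OF norm_cauchy_schwarz] mult_left_mono norm_matrix_vector_le) simp
  finally have "norm ?y * norm ?y \<le> (spec_norm M * norm x) * norm ?y"
    by (simp add: mult_ac)
  then show "norm ?y \<le> spec_norm M * norm x"
    by (cases "norm ?y = 0") (simp_all add: spec_norm_nonneg)
qed

lemma spec_norm_transpose: "spec_norm (transpose M) = spec_norm M"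
  for M :: "real^'n^'m"
  using spec_norm_transpose_le[of M] spec_norm_transpose_le[of "transpose M"] by simp

lemma quadratic_form_le_spec_norm: "x \<bullet> (M *v x) \<le> spec_norm M * (norm x)\<^sup>2"
proof -
  have "x \<bullet> (M *v x) \<le> norm x * (spec_norm M * norm x)"
    by (intro order_trans[OF norm_cauchy_schwarz] mult_left_mono norm_matrix_vector_le) simp
  then show ?thesis by (simp add: power2_eq_square mult_ac)
qed

text \<open>The least eigenvalue is the minimum of the quadratic form on the unit sphere: a minimiser is an
eigenvector, and no eigenvalue is smaller than the minimum.\<close>

lemma lambda_min_le_quadratic_form:
  fixes M :: "real^'n^'n"
  assumes sym: "transpose M = M"
  shows "lambda_min M * (norm v)\<^sup>2 \<le> v \<bullet> (M *v v)"
proof -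
  have "\<exists>x\<in>sphere 0 1. \<forall>y\<in>sphere 0 1. x \<bullet> (M *v x) \<le> y \<bullet> (M *v y)"
    by (intro continuous_attains_inf) (auto intro!: continuous_intros)
  then obtain x where x: "norm x = 1" and min: "\<And>y. norm y = 1 \<Longrightarrow> x \<bullet> (M *v x) \<le> y \<bullet> (M *v y)"
    by auto
  define m where "m = x \<bullet> (M *v x)"
  have lower: "m * (norm y)\<^sup>2 \<le> y \<bullet> (M *v y)" for y
  proof (cases "y = 0")
    case False
    then have "m \<le> (inverse (norm y) *\<^sub>R y) \<bullet> (M *v (inverse (norm y) *\<^sub>R y))"
      unfolding m_def by (intro min) simp
    also have "\<dots> = y \<bullet> (M *v y) / (norm y)\<^sup>2"
      by (simp add: matrix_vector_mult_scaleR power2_eq_square field_simps)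
    finally show ?thesis using False by (simp add: field_simps)
  qed simp
  define z where "z = M *v x - m *\<^sub>R x"
  define q where "q = z \<bullet> (M *v z) - m * (norm z)\<^sup>2"
  have q: "0 \<le> q" using lower[of z] by (simp add: q_def)
  (* The form of M - m I is nonnegative and vanishes at x, so its derivative at x, which is 2z,
     vanishes. The step size |z|^2 / q below minimises the perturbed form. *)
  have perturb: "2 * e * (norm z)\<^sup>2 \<le> e\<^sup>2 * q" for e
  proof -
    have xMz: "x \<bullet> (M *v z) = z \<bullet> (M *v x)"
      by (metis inner_transpose_right sym inner_commute)
    have xx: "x \<bullet> x = 1" using x by (simp add: dot_square_norm)
    have zz: "(norm z)\<^sup>2 = z \<bullet> (M *v x) - m * (z \<bullet> x)"
      unfolding power2_norm_eq_inner by (subst (2) z_def) (simp add: inner_diff_right)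
    have mm: "x \<bullet> (M *v x) = m" by (simp add: m_def)
    have "0 \<le> (x - e *\<^sub>R z) \<bullet> (M *v (x - e *\<^sub>R z)) - m * (norm (x - e *\<^sub>R z))\<^sup>2"
      using lower[of "x - e *\<^sub>R z"] by simp
    also have "\<dots> = - 2 * e * (z \<bullet> (M *v x) - m * (z \<bullet> x)) + e\<^sup>2 * q"
      unfolding q_def power2_norm_eq_inner
      by (simp add: matrix_vector_mult_diff_distrib matrix_vector_mult_scaleR inner_diff_left
          inner_diff_right xMz xx mm inner_commute[of x z] algebra_simps power2_eq_square)
    finally show ?thesis by (simp add: zz)
  qed
  have "z = 0"
  proof (cases "q = 0")
    case True
    then show ?thesis using perturb[of 1] by simp
  next
    case False
    have "2 * ((norm z)\<^sup>2 / q) * (norm z)\<^sup>2 \<le> ((norm z)\<^sup>2 / q)\<^sup>2 * q" by (rule perturb)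
    then have "2 * ((norm z)\<^sup>2)\<^sup>2 \<le> ((norm z)\<^sup>2)\<^sup>2"
      using False q by (simp add: field_simps power2_eq_square)
    then have "((norm z)\<^sup>2)\<^sup>2 \<le> 0" by simp
    then show ?thesis by simp
  qed
  have ev: "eigenvalue M m"
    unfolding eigenvalue_def using \<open>z = 0\<close> x
    by (intro exI[of _ x]) (auto simp: z_def scalar_mult_eq_scaleR)
  have "lambda_min M = m"
    unfolding lambda_min_def
  proof (rule Least_equality)
    show "eigenvalue M m" by (rule ev)
  next
    fix l assume "eigenvalue M l"
    then obtain y where "y \<noteq> 0" and y: "M *v y = l *\<^sub>R y"
      by (auto simp: eigenvalue_def scalar_mult_eq_scaleR)
    then show "m \<le> l"
      using lower[of y] by (simp add: dot_square_norm)
  qed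
  then show ?thesis using lower by simp
qed

lemma transpose_eq_selfI:
  fixes M :: "real^'n^'n"
  assumes "\<And>x y. x \<bullet> (M *v y) = (M *v x) \<bullet> y"
  shows "transpose M = M"
proof -
  have "x \<bullet> (transpose M *v y) = x \<bullet> (M *v y)" for x y
    by (simp add: assms inner_transpose_right)
  then show ?thesis by (metis matrix_eq vector_eq_ldot)
qed

lemma matrix_inv_inverse:
  assumes "invertible M"
  shows "M ** matrix_inv M = mat 1" and "matrix_inv M ** M = mat 1"
  using assms unfolding invertible_def matrix_inv_def by (metis (mono_tags, lifting) someI_ex)+

lemma transpose_matrix_inv:
  fixes M :: "real^'n^'n"
  assumes "invertible M" and "transpose M = M"
  shows "transpose (matrix_inv M) = matrix_inv M"
proof -
  have "transpose (matrix_inv M) ** M = mat 1"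
    by (metis assms matrix_inv_inverse(1) matrix_transpose_mul transpose_mat)
  then show ?thesis
    by (metis assms(1) matrix_inv_inverse(1) matrix_mul_assoc matrix_mul_lid matrix_mul_rid)
qed

lemma pos_def_invertible:
  assumes "pos_def M"
  shows "invertible M"
proof -
  have "x = 0" if "M *v x = 0" for x
    using assms that unfolding pos_def_def by (metis inner_zero_right less_irrefl)
  then have "\<exists>N. N ** M = mat 1"
    by (simp add: matrix_left_invertible_ker)
  then show ?thesis by (simp add: invertible_left_inverse)
qed

section \<open>Square summation over time\<close>

lemma L2_set_sum_le:
  "L2_set (\<lambda>t. \<Sum>i\<in>I. f i t) A \<le> (\<Sum>i\<in>I. L2_set (f i) A)"
proof (induction I rule: infinite_finite_induct)
  case (insert i I)
  then show ?case
    using L2_set_triangle_ineq[of "f i" "\<lambda>t. \<Sum>i\<in>I. f i t" A] by simp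
qed (simp_all add: L2_set_0')

text \<open>Reading a signal at delayed or advanced times only loses part of it when it vanishes outside the
horizon.\<close>

lemma L2_set_shift_le:
  fixes f :: "int \<Rightarrow> real"
  assumes "\<And>s. s < 0 \<or> int T \<le> s \<Longrightarrow> f s = 0"
  shows "L2_set (\<lambda>t. f (int t + j)) {..<T} \<le> L2_set (\<lambda>t. f (int t)) {..<T}"
  unfolding L2_set_def
proof (rule real_sqrt_le_mono)
  have "(\<Sum>t<T. (f (int t + j))\<^sup>2) = (\<Sum>s\<in>(\<lambda>t. int t + j) ` {..<T}. (f s)\<^sup>2)"
    by (subst sum.reindex) (auto simp: inj_on_def)
  also have "\<dots> = (\<Sum>s\<in>(\<lambda>t. int t + j) ` {..<T} \<inter> {0..<int T}. (f s)\<^sup>2)"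
    by (rule sum.mono_neutral_right) (auto intro!: assms simp: not_le not_less)
  also have "\<dots> \<le> (\<Sum>s\<in>{0..<int T}. (f s)\<^sup>2)"
    by (rule sum_mono2) auto
  also have "\<dots> = (\<Sum>s\<in>int ` {..<T}. (f s)\<^sup>2)"
    by (simp add: image_int_atLeastLessThan[of 0, simplified] lessThan_atLeast0)
  also have "\<dots> = (\<Sum>t<T. (f (int t))\<^sup>2)"
    by (subst sum.reindex) (auto simp: inj_on_def)
  finally show "(\<Sum>t<T. (f (int t + j))\<^sup>2) \<le> (\<Sum>t<T. (f (int t))\<^sup>2)" .
qed

section \<open>The matrices of the Riccati feedback\<close>

text \<open>The composite matrices are parameters constrained by equations, so that the facts below can be
instantiated with the explicit expressions of a statement that does not name them.\<close>

locale regulator =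
  fixes A Q P F H S M :: "real^'n^'n"
    and B :: "real^'m^'n" and G :: "real^'n^'m" and R W :: "real^'m^'m"
    and l :: real
  assumes P_psd: "psd P" and R_pos_def: "pos_def R"
    and riccati: "riccati_solution A B Q R P"
    and P_invertible: "invertible P"
    and W_eq: "W = R + transpose B ** P ** B"
    and G_eq: "G = gain B R P"
    and F_eq: "F = closed_loop A B R P"
    and H_eq: "H = B ** G"
    and S_eq: "S = matrix_inv P"
    and M_eq: "M = S - F ** S ** transpose F - H"
    and l_eq: "l = lambda_min M"
    and l_pos: "0 < l"
begin

lemma P_sym: "transpose P = P"
  using P_psd by (simp add: psd_def)

lemma inner_P: "x \<bullet> (P *v y) = (P *v x) \<bullet> y"
  by (metis P_sym inner_transpose_right)

lemma P_nonneg: "0 \<le> x \<bullet> (P *v x)"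
  using P_psd by (simp add: psd_def)

lemma PS: "P *v (S *v x) = x" and SP: "S *v (P *v x) = x"
  using matrix_inv_inverse[OF P_invertible] by (simp_all add: S_eq matrix_vector_mul_assoc)

lemma S_sym: "transpose S = S"
  unfolding S_eq by (rule transpose_matrix_inv[OF P_invertible P_sym])

lemma inner_S: "x \<bullet> (S *v y) = (S *v x) \<bullet> y"
  by (metis S_sym inner_transpose_right)

lemma S_nonneg: "0 \<le> x \<bullet> (S *v x)"
  using P_nonneg[of "S *v x"] by (simp add: PS inner_commute)

lemma bilinear_W: "x \<bullet> (W *v y) = x \<bullet> (R *v y) + (B *v x) \<bullet> (P *v (B *v y))"
  by (simp add: W_eq matrix_vector_mult_add_rdistrib inner_add_right inner_transpose_right
      flip: matrix_vector_mul_assoc)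

lemma W_pos_def: "pos_def W"
proof -
  have "x \<bullet> (R *v y) = (R *v x) \<bullet> y" for x y
    using R_pos_def unfolding pos_def_def by (metis inner_transpose_right)
  then have "x \<bullet> (W *v y) = (W *v x) \<bullet> y" for x y
    using inner_P[of "B *v x" "B *v y"] by (simp add: bilinear_W inner_commute[of _ y])
      (simp add: inner_commute)
  then have "transpose W = W" by (rule transpose_eq_selfI)
  moreover have "0 < x \<bullet> (W *v x)" if "x \<noteq> 0" for x
    using that R_pos_def P_nonneg[of "B *v x"]
    unfolding bilinear_W pos_def_def by (simp add: add_pos_nonneg)
  ultimately show ?thesis by (simp add: pos_def_def)
qed

lemma inner_W: "x \<bullet> (W *v y) = (W *v x) \<bullet> y"
  using W_pos_def unfolding pos_def_def by (metis inner_transpose_right)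

lemma W_nonneg: "0 \<le> x \<bullet> (W *v x)"
  using W_pos_def unfolding pos_def_def by (cases "x = 0") (auto intro: less_imp_le)

lemma inner_W_gain: "x \<bullet> (W *v (G *v y)) = (B *v x) \<bullet> y"
proof -
  have "W ** G = transpose B"
    using matrix_inv_inverse(1)[OF pos_def_invertible[OF W_pos_def]]
    by (simp add: G_eq gain_def W_eq matrix_mul_assoc)
  then show ?thesis
    by (simp add: matrix_vector_mul_assoc inner_transpose_right)
qed

lemma H_mult: "H *v x = B *v (G *v x)"
  by (simp add: H_eq matrix_vector_mul_assoc)

lemma quadratic_form_H: "x \<bullet> (H *v x) = (G *v x) \<bullet> (W *v (G *v x))"
  by (simp add: inner_W_gain H_mult inner_commute[of x])

lemma inner_H: "x \<bullet> (H *v y) = (H *v x) \<bullet> y"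
  by (metis H_mult inner_W inner_W_gain inner_commute)

lemma H_nonneg: "0 \<le> x \<bullet> (H *v x)"
  by (simp add: quadratic_form_H W_nonneg)

lemma F_mult: "F *v x = A *v x - H *v (P *v (A *v x))"
  by (simp add: F_eq closed_loop_def H_eq G_eq matrix_vector_mult_diff_rdistrib
      flip: matrix_vector_mul_assoc)

lemma quadratic_form_P:
  "x \<bullet> (P *v x) = x \<bullet> (Q *v x) + (A *v x) \<bullet> (P *v (A *v x))
     - (P *v (A *v x)) \<bullet> (H *v (P *v (A *v x)))"
proof -
  have "P = Q + transpose A ** P ** A - transpose A ** P ** B ** G ** P ** A"
    using riccati by (simp add: riccati_solution_def G_eq)
  then have "x \<bullet> (P *v x)
      = x \<bullet> ((Q + transpose A ** P ** A - transpose A ** P ** B ** G ** P ** A) *v x)"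
    by metis
  also have "\<dots> = x \<bullet> (Q *v x) + (A *v x) \<bullet> (P *v (A *v x))
     - (A *v x) \<bullet> (P *v (H *v (P *v (A *v x))))"
    by (simp add: matrix_vector_mult_add_rdistrib matrix_vector_mult_diff_rdistrib
        inner_add_right inner_diff_right inner_transpose_right H_mult
        flip: matrix_vector_mul_assoc)
  finally show ?thesis by (simp add: inner_P)
qed

lemma quadratic_form_M:
  "x \<bullet> (M *v x) = x \<bullet> (S *v x) - (transpose F *v x) \<bullet> (S *v (transpose F *v x)) - x \<bullet> (H *v x)"
  by (simp add: M_eq matrix_vector_mult_diff_rdistrib inner_diff_right inner_transpose_left
      flip: matrix_vector_mul_assoc)

text \<open>All consequences of the eigenvalue condition are drawn from this bound.\<close>

lemma M_lower: "l * (norm x)\<^sup>2 \<le> x \<bullet> (M *v x)"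
proof -
  have "x \<bullet> (M *v y) = (M *v x) \<bullet> y" for x y
    using inner_H[of x y] inner_S[of x y] inner_S[of "transpose F *v x" "transpose F *v y"]
    by (simp add: M_eq matrix_vector_mult_diff_rdistrib inner_diff_left inner_diff_right
        inner_transpose_left inner_transpose_right flip: matrix_vector_mul_assoc)
  then have "transpose M = M" by (rule transpose_eq_selfI)
  then show ?thesis unfolding l_eq by (rule lambda_min_le_quadratic_form)
qed

lemma S_lower: "l * (norm x)\<^sup>2 \<le> x \<bullet> (S *v x)"
  using M_lower[of x] S_nonneg[of "transpose F *v x"] H_nonneg[of x]
  by (simp add: quadratic_form_M)

section \<open>Completing the square\<close>

text \<open>The optimal cost from state \<open>x\<close>, up to a term that depends on the disturbances alone, when \<open>v\<close> is
the effect \<open>F\<^sup>T \<psi>\<close> of the disturbances to come. The summand \<open>v \<bullet> S v\<close> is part of that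
term; including it makes the function a square and lets the remaining terms appear as \<open>\<psi> \<bullet> M \<psi>\<close>.\<close>

definition value_fn :: "real^'n \<Rightarrow> real^'n \<Rightarrow> real" where
  "value_fn x v = x \<bullet> (P *v x) + 2 * (x \<bullet> v) + v \<bullet> (S *v v)"

lemma value_nonneg: "0 \<le> value_fn x v"
proof -
  have "value_fn x v = (P *v x + v) \<bullet> (S *v (P *v x + v))"
    using inner_S[of "P *v x" v]
    by (simp add: value_fn_def matrix_vector_right_distrib inner_add_left inner_add_right SP
        inner_commute)
  then show ?thesis by (simp add: S_nonneg)
qed

text \<open>The cost of one step plus the optimal cost of the rest is quadratic in \<open>u\<close> with leading matrix
\<open>W\<close> and minimiser \<open>-G (P A x + q)\<close>; the Riccati equation identifies the terms in \<open>x\<close> that remain at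
the minimum as \<open>x \<bullet> P x\<close>, and \<open>F = A - H P A\<close> identifies those linear in \<open>x\<close>.\<close>

lemma bellman_identity:
  assumes q: "q = P *v w + v"
    and z: "z = u + G *v (P *v (A *v x) + q)"
  shows "x \<bullet> (Q *v x) + u \<bullet> (R *v u) + value_fn (A *v x + B *v u + w) v
       = value_fn x (transpose F *v q) + q \<bullet> (M *v q) + z \<bullet> (W *v z)"
proof -
  define p where "p = P *v (A *v x)"
  have zWz: "z \<bullet> (W *v z) = u \<bullet> (R *v u) + (B *v u) \<bullet> (P *v (B *v u))
      + 2 * ((B *v u) \<bullet> (p + q)) + (p + q) \<bullet> (H *v (p + q))"
  proof -
    define g where "g = G *v (p + q)"
    have "g \<bullet> (W *v g) = (p + q) \<bullet> (H *v (p + q))"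
      by (simp only: quadratic_form_H g_def)
    moreover have "u \<bullet> (W *v g) = (B *v u) \<bullet> (p + q)"
      by (simp only: inner_W_gain g_def)
    moreover have "z = u + g" by (simp add: z p_def g_def)
    ultimately show ?thesis
      using inner_W[of g u] bilinear_W[of u u]
      by (simp add: matrix_vector_right_distrib inner_add_left inner_add_right inner_commute)
  qed
  have H: "(p + q) \<bullet> (H *v (p + q)) = p \<bullet> (H *v p) + 2 * ((H *v p) \<bullet> q) + q \<bullet> (H *v q)"
    using inner_H[of p q]
    by (simp add: matrix_vector_right_distrib inner_add_left inner_add_right inner_commute)
  have S: "q \<bullet> (S *v q) = w \<bullet> (P *v w) + 2 * (w \<bullet> v) + v \<bullet> (S *v v)"
    using inner_P[of w "S *v v"]
    by (simp add: q matrix_vector_right_distrib inner_add_left inner_add_right SP PS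
        inner_commute)
  have F: "x \<bullet> (transpose F *v q) = (A *v x) \<bullet> q - (H *v p) \<bullet> q"
    by (simp add: inner_transpose_right F_mult inner_diff_left p_def)
  have next_value: "value_fn (A *v x + B *v u + w) v = (A *v x) \<bullet> p + (B *v u) \<bullet> (P *v (B *v u))
      + w \<bullet> (P *v w) + 2 * ((B *v u) \<bullet> (p + q)) + 2 * ((A *v x) \<bullet> q) + 2 * (w \<bullet> v)
      + v \<bullet> (S *v v)"
    using inner_P[of "A *v x" "B *v u"] inner_P[of "A *v x" w] inner_P[of w "B *v u"]
    by (simp add: value_fn_def matrix_vector_right_distrib inner_add_left inner_add_right p_def q
        inner_commute algebra_simps)
  show ?thesis
    unfolding next_value zWz H value_fn_def[of x] F quadratic_form_M S
    using quadratic_form_P[of x, folded p_def] by simp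
qed

section \<open>The cost as optimal cost plus squared deviations\<close>

text \<open>The part beyond the horizon is cut off rather than left to the disturbances being zero there, so
that the tail vanishes after the horizon by definition.\<close>

definition tail :: "(int \<Rightarrow> real^'n) \<Rightarrow> nat \<Rightarrow> nat \<Rightarrow> real^'n" where
  "tail w T t = (\<Sum>i<T-t. matpow (transpose F) i *v (P *v w (int t + int i)))"

text \<open>The difference between the control applied and the control that is optimal from the current state
when all disturbances are known.\<close>

definition deviation ::
  "real^'n \<Rightarrow> (int \<Rightarrow> real^'n) \<Rightarrow> nat \<Rightarrow> (nat \<Rightarrow> real^'m) \<Rightarrow> nat \<Rightarrow> real^'m" where
  "deviation x0 w T u t = u t + G *v (P *v (A *v state A B x0 w u t) + tail w T t)"

definition offline_cost :: "real^'n \<Rightarrow> (int \<Rightarrow> real^'n) \<Rightarrow> nat \<Rightarrow> real" where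
  "offline_cost x0 w T = value_fn x0 (transpose F *v tail w T 0)
     + (\<Sum>t<T. tail w T t \<bullet> (M *v tail w T t))"

lemma tail_beyond: "T \<le> t \<Longrightarrow> tail w T t = 0"
  by (simp add: tail_def)

lemma tail_rec:
  assumes "\<forall>s\<ge>int T. w s = 0"
  shows "tail w T t = P *v w (int t) + transpose F *v tail w T (Suc t)"
proof (cases "t < T")
  case True
  then have "T - t = Suc (T - Suc t)" by simp
  then show ?thesis
    by (simp add: tail_def sum.lessThan_Suc_shift matrix_vector_mult_sum algebra_simps
        flip: matrix_vector_mul_assoc del: sum.lessThan_Suc)
next
  case False
  then show ?thesis by (simp add: tail_beyond assms)
qed

lemma tail_unroll:
  assumes "\<forall>s\<ge>int T. w s = 0"
  shows "tail w T t = (\<Sum>i<n. matpow (transpose F) i *v (P *v w (int t + int i)))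
     + matpow (transpose F) n *v tail w T (t + n)"
proof (induction n)
  case (Suc n)
  have "matpow (transpose F) n *v tail w T (t + n)
      = matpow (transpose F) n *v (P *v w (int t + int n))
        + matpow (transpose F) (Suc n) *v tail w T (t + Suc n)"
    by (subst tail_rec[OF assms])
      (simp_all add: matpow_Suc_right matrix_vector_right_distrib flip: matrix_vector_mul_assoc
        del: matpow.simps(2))
  then show ?case using Suc by (simp add: add.assoc del: matpow.simps(2))
qed simp

text \<open>Summing the one-step identity over time telescopes the optimal costs. Since only the last sum
depends on the controls and it is nonnegative, the first term is the optimum for the terminal
weight \<open>P\<close>.\<close>

lemma cost_eq_offline_cost:
  assumes "\<forall>s\<ge>int T. w s = 0"
  shows "cost A B Q R P x0 T w u
     = offline_cost x0 w T + (\<Sum>t<T. deviation x0 w T u t \<bullet> (W *v deviation x0 w T u t))"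
proof -
  let ?x = "state A B x0 w u" and ?v = "\<lambda>t. transpose F *v tail w T t"
  let ?z = "deviation x0 w T u"
  have "(\<Sum>t<n. ?x t \<bullet> (Q *v ?x t) + u t \<bullet> (R *v u t)) + value_fn (?x n) (?v n)
      = value_fn x0 (?v 0) + (\<Sum>t<n. tail w T t \<bullet> (M *v tail w T t))
        + (\<Sum>t<n. ?z t \<bullet> (W *v ?z t))" for n
  proof (induction n)
    case (Suc n)
    have "?z n = u n + G *v (P *v (A *v ?x n) + tail w T n)" by (simp add: deviation_def)
    from Suc bellman_identity[OF tail_rec[OF assms, of n] this] show ?case by simp
  qed simp
  from this[of T] show ?thesis
    by (simp add: cost_def Let_def offline_cost_def tail_beyond value_fn_def)
qed

lemma cost_terminal_change:
  "cost A B Q R Qf x0 T w u = cost A B Q R P x0 T w u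
     - state A B x0 w u T \<bullet> (P *v state A B x0 w u T)
     + state A B x0 w u T \<bullet> (Qf *v state A B x0 w u T)"
  by (simp add: cost_def Let_def)

text \<open>The disturbances force a cost that no control avoids, measured by their tails.\<close>

lemma offline_cost_lower: "l * (\<Sum>t<T. (norm (tail w T t))\<^sup>2) \<le> offline_cost x0 w T"
  unfolding offline_cost_def sum_distrib_left
  using sum_mono[of "{..<T}", OF M_lower[of "tail w T _"]] value_nonneg[of x0]
  by (simp add: add_increasing)

text \<open>In terms of the deviations the dynamics are those of the stable matrix \<open>F\<close>, driven by the tails.\<close>

lemma state_closed_loop:
  "state A B x0 w u t
     = state F B x0 (\<lambda>s. w s - H *v tail w T (nat s)) (deviation x0 w T u) t"
proof (induction t)
  case (Suc t)
  have "A *v state A B x0 w u t + B *v u t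
      = F *v state A B x0 w u t - H *v tail w T t + B *v deviation x0 w T u t"
    by (simp add: deviation_def F_mult H_mult matrix_vector_right_distrib)
  with Suc show ?case by (simp add: algebra_simps)
qed simp

lemma state_superposition:
  "state F B x0 q z n = state F B x0 q (\<lambda>_. 0) n + state F B 0 (\<lambda>_. 0) z n"
  by (induction n) (simp_all add: matrix_vector_right_distrib algebra_simps)

lemma state_solution:
  "state F B x0 q z n = matpow F n *v x0
     + (\<Sum>i<n. matpow F i *v (B *v z (n - Suc i) + q (int (n - Suc i))))"
proof (induction n)
  case (Suc n)
  then show ?case
    by (simp add: sum.lessThan_Suc_shift matrix_vector_right_distrib matrix_vector_mult_sum
        flip: matrix_vector_mul_assoc del: sum.lessThan_Suc)
qed simp

section \<open>Stability of the closed loop\<close>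

lemma spec_norm_S: "l \<le> spec_norm S"
proof -
  obtain v :: "real^'n" where "norm v = 1" using vector_choose_size[of 1] by auto
  then show ?thesis
    using S_lower[of v] quadratic_form_le_spec_norm[of v S] by simp
qed

text \<open>Since \<open>S - F S F\<^sup>T \<ge> M \<ge> l\<close> and \<open>S \<le> \<parallel>S\<parallel>\<close> as quadratic forms, one application of
\<open>F\<^sup>T\<close> shrinks the form of \<open>S\<close> by the factor \<open>1 - l / \<parallel>S\<parallel>\<close>. So \<open>S\<close> is a Lyapunov function
for the transposed dynamics.\<close>

lemma F_power_decay:
  "l * (norm (matpow (transpose F) i *v v))\<^sup>2
     \<le> (1 - l / spec_norm S) ^ i * (spec_norm S * (norm v)\<^sup>2)"
proof -
  let ?g = "1 - l / spec_norm S" and ?Y = "\<lambda>i. matpow (transpose F) i *v v"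
  have pos: "0 < spec_norm S" and g: "0 \<le> ?g" using spec_norm_S l_pos by simp_all
  have contract: "(transpose F *v y) \<bullet> (S *v (transpose F *v y)) \<le> ?g * (y \<bullet> (S *v y))" for y
  proof -
    have "l / spec_norm S * (y \<bullet> (S *v y)) \<le> l / spec_norm S * (spec_norm S * (norm y)\<^sup>2)"
      using pos l_pos by (intro mult_left_mono quadratic_form_le_spec_norm) simp
    then have "l / spec_norm S * (y \<bullet> (S *v y)) \<le> l * (norm y)\<^sup>2" using pos by simp
    moreover have "(transpose F *v y) \<bullet> (S *v (transpose F *v y)) \<le> y \<bullet> (S *v y) - l * (norm y)\<^sup>2"
      using M_lower[of y] H_nonneg[of y] by (simp add: quadratic_form_M)
    ultimately show ?thesis by (simp add: left_diff_distrib)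
  qed
  have "?Y i \<bullet> (S *v ?Y i) \<le> ?g ^ i * (v \<bullet> (S *v v))"
  proof (induction i)
    case (Suc i)
    have "?Y (Suc i) \<bullet> (S *v ?Y (Suc i)) \<le> ?g * (?Y i \<bullet> (S *v ?Y i))"
      using contract[of "?Y i"] by (simp add: matrix_vector_mul_assoc)
    also have "\<dots> \<le> ?g * (?g ^ i * (v \<bullet> (S *v v)))"
      using g Suc by (rule mult_left_mono[rotated])
    finally show ?case by (simp add: mult.assoc)
  qed simp
  also have "\<dots> \<le> ?g ^ i * (spec_norm S * (norm v)\<^sup>2)"
    using g by (intro mult_left_mono quadratic_form_le_spec_norm) simp
  finally show ?thesis using S_lower[of "?Y i"] by simp
qed

lemma F_powers_summable: "\<exists>L. \<forall>n. (\<Sum>i<n. spec_norm (matpow F i)) \<le> L"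
proof -
  define g where "g = sqrt (1 - l / spec_norm S)"
  define K where "K = sqrt (spec_norm S / l)"
  have pos: "0 < spec_norm S" using spec_norm_S l_pos by simp
  have g: "0 \<le> g" "g < 1" "g\<^sup>2 = 1 - l / spec_norm S"
    using spec_norm_S l_pos pos by (simp_all add: g_def real_less_lsqrt)
  have K: "0 \<le> K" "K\<^sup>2 = spec_norm S / l" using pos l_pos by (simp_all add: K_def)
  have F_pow: "spec_norm (matpow F i) \<le> K * g ^ i" for i
  proof -
    have "norm (matpow (transpose F) i *v v) \<le> K * g ^ i * norm v" for v
    proof (rule power2_le_imp_le)
      have "(norm (matpow (transpose F) i *v v))\<^sup>2 \<le> (g\<^sup>2) ^ i * (spec_norm S * (norm v)\<^sup>2) / l"
        using F_power_decay[of i v] l_pos by (simp add: g(3) field_simps)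
      also have "\<dots> = (K * g ^ i * norm v)\<^sup>2"
        by (simp add: power_mult_distrib K(2) power_mult[symmetric] mult.commute)
      finally show "(norm (matpow (transpose F) i *v v))\<^sup>2 \<le> (K * g ^ i * norm v)\<^sup>2" .
    qed (use K g in simp)
    then have "spec_norm (matpow (transpose F) i) \<le> K * g ^ i" by (rule spec_norm_leI)
    then show ?thesis by (simp add: transpose_matpow spec_norm_transpose)
  qed
  have "(\<Sum>i<n. spec_norm (matpow F i)) \<le> K / (1 - g)" for n
  proof -
    have "(\<Sum>i<n. spec_norm (matpow F i)) \<le> (\<Sum>i<n. K * g ^ i)" by (intro sum_mono F_pow)
    also have "\<dots> = K * ((1 - g ^ n) / (1 - g))"
      using g(2) by (simp add: sum_gp_strict flip: sum_distrib_left)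
    also have "\<dots> \<le> K * (1 / (1 - g))"
      using g K by (intro mult_left_mono divide_right_mono) simp_all
    finally show ?thesis by simp
  qed
  then show ?thesis by blast
qed

lemma norm_tail_le:
  assumes L: "\<And>n. (\<Sum>i<n. spec_norm (matpow F i)) \<le> L"
    and w: "\<And>s. norm (w s) \<le> r"
  shows "norm (tail w T t) \<le> L * (spec_norm P * r)"
proof -
  have r: "0 \<le> r" using w[of 0] norm_ge_zero order_trans by blast
  have "norm (tail w T t) \<le> (\<Sum>i<T-t. spec_norm (matpow F i) * (spec_norm P * r))"
    unfolding tail_def
  proof (rule sum_norm_le)
    fix i
    have "norm (matpow (transpose F) i *v (P *v w (int t + int i)))
        \<le> spec_norm (matpow (transpose F) i) * norm (P *v w (int t + int i))"
      by (rule norm_matrix_vector_le)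
    also have "\<dots> \<le> spec_norm (matpow (transpose F) i) * (spec_norm P * r)"
      by (intro mult_left_mono order_trans[OF norm_matrix_vector_le] spec_norm_nonneg w)
    finally show "norm (matpow (transpose F) i *v (P *v w (int t + int i)))
        \<le> spec_norm (matpow F i) * (spec_norm P * r)"
      by (simp add: transpose_matpow spec_norm_transpose)
  qed
  also have "\<dots> \<le> L * (spec_norm P * r)"
    unfolding sum_distrib_right[symmetric]
    using L r by (intro mult_right_mono) (simp_all add: spec_norm_nonneg)
  finally show ?thesis .
qed

text \<open>The input and the disturbance are bounded jointly, since only their sum drives the state.\<close>

lemma norm_state_le:
  assumes L: "\<And>n. (\<Sum>i<n. spec_norm (matpow F i)) \<le> L"
    and g: "\<And>t. t < n \<Longrightarrow> norm (B *v z t + q (int t)) \<le> g" and "0 \<le> g"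
  shows "norm (state F B x0 q z n) \<le> L * (norm x0 + g)"
proof -
  have "spec_norm (matpow F n) \<le> (\<Sum>i<Suc n. spec_norm (matpow F i))"
    by (simp add: sum_nonneg spec_norm_nonneg)
  also note L
  finally have "norm (matpow F n *v x0) \<le> L * norm x0"
    using order_trans[OF norm_matrix_vector_le mult_right_mono] by simp
  moreover have "norm (\<Sum>i<n. matpow F i *v (B *v z (n - Suc i) + q (int (n - Suc i)))) \<le> L * g"
  proof -
    have "norm (\<Sum>i<n. matpow F i *v (B *v z (n - Suc i) + q (int (n - Suc i))))
        \<le> (\<Sum>i<n. spec_norm (matpow F i) * g)"
      by (intro sum_norm_le order_trans[OF norm_matrix_vector_le] mult_left_mono
          spec_norm_nonneg g) auto
    also have "\<dots> \<le> L * g"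
      unfolding sum_distrib_right[symmetric] using L \<open>0 \<le> g\<close> by (intro mult_right_mono)
    finally show ?thesis .
  qed
  ultimately show ?thesis
    unfolding state_solution by (intro norm_triangle_le) (simp add: distrib_left)
qed

section \<open>Comparison of terminal costs\<close>

text \<open>This is the Fenchel form of a bound on the energy needed to reach a state from 0: with
\<open>y\<close> ranging over all vectors it says that the controllability Gramian
\<open>\<Sum>\<^sub>i F\<^sup>i H (F\<^sup>T)\<^sup>i\<close> is at most \<open>S - l\<close>, which follows from \<open>H \<le> S - F S F\<^sup>T - l\<close> by
telescoping. The linear form makes the induction step a sum of two inequalities.\<close>

lemma reachability_energy:
  "2 * (y \<bullet> state F B 0 (\<lambda>_. 0) z n) \<le> y \<bullet> (S *v y) - l * (norm y)\<^sup>2 + (\<Sum>t<n. z t \<bullet> (W *v z t))"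
proof (induction n arbitrary: y)
  case 0
  then show ?case using S_lower[of y] by simp
next
  case (Suc n)
  let ?x = "state F B 0 (\<lambda>_. 0) z n"
  have "0 \<le> (z n - G *v y) \<bullet> (W *v (z n - G *v y))" by (rule W_nonneg)
  then have input: "2 * (y \<bullet> (B *v z n)) \<le> y \<bullet> (H *v y) + z n \<bullet> (W *v z n)"
    using inner_W[of "G *v y" "z n"] inner_W_gain[of "z n" y] quadratic_form_H[of y]
    by (simp add: matrix_vector_mult_diff_distrib inner_diff_left inner_diff_right inner_commute)
  have "0 \<le> l * (norm (transpose F *v y))\<^sup>2" using l_pos by simp
  moreover have "y \<bullet> (F *v ?x) = (transpose F *v y) \<bullet> ?x" by (simp add: inner_transpose_left)
  ultimately show ?case
    using Suc.IH[of "transpose F *v y"] input M_lower[of y]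
    by (simp add: inner_add_right quadratic_form_M)
qed

text \<open>The number \<open>X\<close> bounds the final state \<open>b\<close> of the trajectory that is optimal for the terminal weight
\<open>P\<close>. Other controls end in \<open>b + e\<close>, and the energy spent on \<open>e\<close> pays for \<open>e \<bullet> P e\<close> and, with the
surplus \<open>l \<parallel>P e\<parallel>\<^sup>2\<close>, for the cross term \<open>2 (b \<bullet> P e)\<close>.\<close>

lemma offline_cost_le_cost:
  assumes w: "\<forall>s\<ge>int T. w s = 0" and Qf: "psd Qf"
    and X: "norm (state F B x0 (\<lambda>s. w s - H *v tail w T (nat s)) (\<lambda>_. 0) T) \<le> X"
  shows "offline_cost x0 w T \<le> cost A B Q R Qf x0 T w u + (X\<^sup>2 / l + spec_norm P * X\<^sup>2)"
proof -
  define b where "b = state F B x0 (\<lambda>s. w s - H *v tail w T (nat s)) (\<lambda>_. 0) T"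
  define e where "e = state F B 0 (\<lambda>_. 0) (deviation x0 w T u) T"
  let ?E = "\<Sum>t<T. deviation x0 w T u t \<bullet> (W *v deviation x0 w T u t)"
  have x: "state A B x0 w u T = b + e"
    by (subst state_closed_loop[where T = T], subst state_superposition) (simp add: b_def e_def)
  (* The energy bound is applied with y = P e, where y . e = y . S y = e . P e. *)
  have energy: "e \<bullet> (P *v e) + l * (norm (P *v e))\<^sup>2 \<le> ?E"
    using reachability_energy[of "P *v e" "deviation x0 w T u" T]
    by (simp add: SP inner_commute flip: e_def)
  have X2: "(norm b)\<^sup>2 \<le> X\<^sup>2" using X by (simp add: b_def power_mono)
  have "0 \<le> (norm ((1 / l) *\<^sub>R b - P *v e))\<^sup>2 * l" using l_pos by simp
  also have "\<dots> = (norm b)\<^sup>2 / l - 2 * (b \<bullet> (P *v e)) + l * (norm (P *v e))\<^sup>2"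
    using l_pos unfolding power2_norm_eq_inner
    by (simp add: inner_diff_left inner_diff_right inner_commute field_simps power2_eq_square)
  finally have cross: "2 * (b \<bullet> (P *v e)) \<le> (norm b)\<^sup>2 / l + l * (norm (P *v e))\<^sup>2" by simp
  have "b \<bullet> (P *v b) \<le> spec_norm P * X\<^sup>2"
    using X2 by (intro order_trans[OF quadratic_form_le_spec_norm] mult_left_mono spec_norm_nonneg)
  moreover have "(norm b)\<^sup>2 / l \<le> X\<^sup>2 / l" using X2 l_pos by (simp add: divide_right_mono)
  moreover have "(b + e) \<bullet> (P *v (b + e)) = b \<bullet> (P *v b) + 2 * (b \<bullet> (P *v e)) + e \<bullet> (P *v e)"
    using inner_P[of e b]
    by (simp add: matrix_vector_right_distrib inner_add_left inner_add_right inner_commute)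
  moreover have "0 \<le> (b + e) \<bullet> (Qf *v (b + e))" using Qf by (simp add: psd_def)
  ultimately show ?thesis
    unfolding cost_terminal_change[of Qf] cost_eq_offline_cost[OF w] x
    using energy cross by linarith
qed

section \<open>Controls with small deviations are competitive\<close>

lemma L2_tail_shift_le:
  "L2_set (\<lambda>t. norm (tail w T (t + m))) {..<T} \<le> L2_set (\<lambda>t. norm (tail w T t)) {..<T}"
proof -
  let ?f = "\<lambda>s. if s < 0 then 0 else norm (tail w T (nat s))"
  have "?f s = 0" if "s < 0 \<or> int T \<le> s" for s
    using that by (auto simp: tail_beyond le_nat_iff)
  from L2_set_shift_le[of T ?f "int m", OF this] show ?thesis
    by (simp add: nat_int_add)
qed

text \<open>The recursion of the tails expresses a disturbance by two consecutive tails; this is where the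
factor \<open>\<parallel>S\<parallel> (1 + \<parallel>F\<parallel>)\<close> of the constant \<open>c\<close> comes from.\<close>

lemma L2_disturbance_le:
  assumes w: "\<forall>s. s < 0 \<or> int T \<le> s \<longrightarrow> w s = 0"
  shows "L2_set (\<lambda>t. norm (w (int t + j))) {..<T}
     \<le> spec_norm S * (1 + spec_norm F) * L2_set (\<lambda>t. norm (tail w T t)) {..<T}"
proof -
  have norm_w: "norm (w (int t))
      \<le> spec_norm S * norm (tail w T t) + spec_norm S * spec_norm F * norm (tail w T (t + 1))" for t
  proof -
    have "w (int t) = S *v (tail w T t - transpose F *v tail w T (t + 1))"
      using tail_rec[of T w t] w by (simp add: SP)
    then have "norm (w (int t))
        \<le> spec_norm S * norm (tail w T t - transpose F *v tail w T (t + 1))"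
      by (simp add: norm_matrix_vector_le)
    also have "\<dots> \<le> spec_norm S * (norm (tail w T t)
        + spec_norm (transpose F) * norm (tail w T (t + 1)))"
      by (intro mult_left_mono spec_norm_nonneg order_trans[OF norm_triangle_ineq4] add_left_mono
          norm_matrix_vector_le)
    finally show ?thesis by (simp add: spec_norm_transpose distrib_left mult.assoc)
  qed
  have "L2_set (\<lambda>t. norm (w (int t + j))) {..<T} \<le> L2_set (\<lambda>t. norm (w (int t))) {..<T}"
    using w by (intro L2_set_shift_le) auto
  also have "\<dots> \<le> L2_set (\<lambda>t. spec_norm S * norm (tail w T t)
      + spec_norm S * spec_norm F * norm (tail w T (t + 1))) {..<T}"
    by (intro L2_set_mono norm_w) simp
  also have "\<dots> \<le> L2_set (\<lambda>t. spec_norm S * norm (tail w T t)) {..<T}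
      + L2_set (\<lambda>t. spec_norm S * spec_norm F * norm (tail w T (t + 1))) {..<T}"
    by (rule L2_set_triangle_ineq)
  also have "\<dots> = spec_norm S * L2_set (\<lambda>t. norm (tail w T t)) {..<T}
      + spec_norm S * spec_norm F * L2_set (\<lambda>t. norm (tail w T (t + 1))) {..<T}"
    by (simp add: L2_set_right_distrib spec_norm_nonneg)
  also have "\<dots> \<le> spec_norm S * L2_set (\<lambda>t. norm (tail w T t)) {..<T}
      + spec_norm S * spec_norm F * L2_set (\<lambda>t. norm (tail w T t)) {..<T}"
    by (intro add_left_mono mult_left_mono L2_tail_shift_le mult_nonneg_nonneg spec_norm_nonneg)
  finally show ?thesis by (simp add: algebra_simps)
qed

text \<open>Only the form of the deviations matters: delay and predictions enter through the weights \<open>a\<close> of the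
unknown disturbances, their time shifts \<open>j\<close>, and the weight \<open>b\<close> of the tail at distance \<open>m\<close>.
The bound follows from Minkowski's inequality in the space of sequences of length \<open>T\<close>.\<close>

lemma cost_le_offline_cost:
  fixes a :: "'i \<Rightarrow> real" and j :: "'i \<Rightarrow> int"
  assumes w: "\<forall>s. s < 0 \<or> int T \<le> s \<longrightarrow> w s = 0"
    and a: "\<And>i. 0 \<le> a i" and b: "0 \<le> b"
    and dev: "\<And>t. t < T \<Longrightarrow> deviation x0 w T u t = G *v h t"
    and h: "\<And>t. t < T \<Longrightarrow>
       norm (h t) \<le> (\<Sum>i\<in>I. a i * norm (w (int t + j i))) + b * norm (tail w T (t + m))"
  shows "cost A B Q R P x0 T w u
     \<le> ((spec_norm S * (1 + spec_norm F) * (\<Sum>i\<in>I. a i) + b)\<^sup>2 * spec_norm H / l + 1)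
         * offline_cost x0 w T"
proof -
  define D where "D = L2_set (\<lambda>t. norm (tail w T t)) {..<T}"
  define \<kappa> where "\<kappa> = spec_norm S * (1 + spec_norm F) * (\<Sum>i\<in>I. a i) + b"
  have D: "0 \<le> D" "l * D\<^sup>2 \<le> offline_cost x0 w T"
    using offline_cost_lower[of w T x0] by (simp_all add: D_def L2_set_def sum_nonneg)
  have "L2_set (\<lambda>t. norm (h t)) {..<T}
      \<le> L2_set (\<lambda>t. (\<Sum>i\<in>I. a i * norm (w (int t + j i))) + b * norm (tail w T (t + m))) {..<T}"
    using h by (intro L2_set_mono) auto
  also have "\<dots> \<le> L2_set (\<lambda>t. \<Sum>i\<in>I. a i * norm (w (int t + j i))) {..<T}
      + L2_set (\<lambda>t. b * norm (tail w T (t + m))) {..<T}"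
    by (rule L2_set_triangle_ineq)
  also have "\<dots> \<le> (\<Sum>i\<in>I. L2_set (\<lambda>t. a i * norm (w (int t + j i))) {..<T})
      + L2_set (\<lambda>t. b * norm (tail w T (t + m))) {..<T}"
    by (intro add_right_mono L2_set_sum_le)
  also have "\<dots> = (\<Sum>i\<in>I. a i * L2_set (\<lambda>t. norm (w (int t + j i))) {..<T})
      + b * L2_set (\<lambda>t. norm (tail w T (t + m))) {..<T}"
    using a b by (simp add: L2_set_right_distrib)
  also have "\<dots> \<le> (\<Sum>i\<in>I. a i * (spec_norm S * (1 + spec_norm F) * D)) + b * D"
    unfolding D_def
    using a b by (intro add_mono sum_mono mult_left_mono L2_disturbance_le w L2_tail_shift_le)
  also have "\<dots> = \<kappa> * D"
    by (simp add: \<kappa>_def algebra_simps sum_distrib_left sum_distrib_right sum.distrib)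
  finally have h_le: "L2_set (\<lambda>t. norm (h t)) {..<T} \<le> \<kappa> * D" .
  have "(\<Sum>t<T. deviation x0 w T u t \<bullet> (W *v deviation x0 w T u t))
      = (\<Sum>t<T. h t \<bullet> (H *v h t))"
    using dev by (intro sum.cong) (simp_all add: quadratic_form_H)
  also have "\<dots> \<le> (\<Sum>t<T. spec_norm H * (norm (h t))\<^sup>2)"
    by (intro sum_mono quadratic_form_le_spec_norm)
  also have "\<dots> = spec_norm H * (L2_set (\<lambda>t. norm (h t)) {..<T})\<^sup>2"
    by (simp add: L2_set_def sum_nonneg sum_distrib_left)
  also have "\<dots> \<le> spec_norm H * (\<kappa> * D)\<^sup>2"
    by (intro mult_left_mono power_mono h_le spec_norm_nonneg) simp
  also have "\<dots> = \<kappa>\<^sup>2 * spec_norm H / l * (l * D\<^sup>2)"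
    using l_pos by (simp add: power_mult_distrib)
  also have "\<dots> \<le> \<kappa>\<^sup>2 * spec_norm H / l * offline_cost x0 w T"
    using l_pos by (intro mult_left_mono D(2)) (simp add: spec_norm_nonneg)
  finally show ?thesis
    using w by (simp add: cost_eq_offline_cost \<kappa>_def distrib_right)
qed

text \<open>Bounded disturbances have bounded tails, so the deviations are bounded, and the closed loop is
stable. The bound has to hold for all horizons at once, hence the order of the quantifiers.\<close>

lemma bounded_trajectories:
  fixes a :: "'i \<Rightarrow> real" and j :: "'i \<Rightarrow> int"
  assumes a: "\<And>i. 0 \<le> a i" and b: "0 \<le> b" and r: "0 \<le> r"
  shows "\<exists>X. \<forall>T w u h. (\<forall>s. norm (w s) \<le> r) \<longrightarrow>
     (\<forall>t<T. deviation x0 w T u t = G *v h t \<and>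
        norm (h t) \<le> (\<Sum>i\<in>I. a i * norm (w (int t + j i))) + b * norm (tail w T (t + m))) \<longrightarrow>
     norm (state A B x0 w u T) \<le> X \<and>
     norm (state F B x0 (\<lambda>s. w s - H *v tail w T (nat s)) (\<lambda>_. 0) T) \<le> X"
proof -
  obtain L where L: "\<And>n. (\<Sum>i<n. spec_norm (matpow F i)) \<le> L"
    using F_powers_summable by blast
  define c where "c = L * (spec_norm P * r)"
  define e where "e = (\<Sum>i\<in>I. a i * r) + b * c"
  define g where "g = spec_norm H * e + (r + spec_norm H * c)"
  have "0 \<le> L" using L[of 0] by simp
  then have c: "0 \<le> c" using r by (simp add: c_def spec_norm_nonneg)
  then have e: "0 \<le> e" using a b r by (simp add: e_def sum_nonneg)
  have g: "r + spec_norm H * c \<le> g" "0 \<le> g" using e c r by (simp_all add: g_def spec_norm_nonneg)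
  have "norm (state A B x0 w u T) \<le> L * (norm x0 + g)
      \<and> norm (state F B x0 (\<lambda>s. w s - H *v tail w T (nat s)) (\<lambda>_. 0) T) \<le> L * (norm x0 + g)"
    if w: "\<forall>s. norm (w s) \<le> r"
      and dev: "\<forall>t<T. deviation x0 w T u t = G *v h t \<and>
        norm (h t) \<le> (\<Sum>i\<in>I. a i * norm (w (int t + j i))) + b * norm (tail w T (t + m))"
    for T w u h
  proof -
    have tail: "norm (tail w T t) \<le> c" for t
      unfolding c_def using w by (intro norm_tail_le L) simp
    have free: "norm (w (int t) - H *v tail w T t) \<le> r + spec_norm H * c" for t
      using w by (intro order_trans[OF norm_triangle_ineq4] add_mono order_trans[OF
          norm_matrix_vector_le] mult_left_mono tail spec_norm_nonneg) simp
    have forced: "norm (B *v deviation x0 w T u t) \<le> spec_norm H * e" if "t < T" for t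
    proof -
      have "norm (h t) \<le> (\<Sum>i\<in>I. a i * norm (w (int t + j i))) + b * norm (tail w T (t + m))"
        using dev that by blast
      also have "\<dots> \<le> e"
        unfolding e_def using w a b by (intro add_mono sum_mono mult_left_mono tail) simp_all
      finally have "norm (H *v h t) \<le> spec_norm H * e"
        by (intro order_trans[OF norm_matrix_vector_le] mult_left_mono spec_norm_nonneg)
      then show ?thesis using dev that by (simp add: H_mult)
    qed
    show ?thesis
    proof
      show "norm (state A B x0 w u T) \<le> L * (norm x0 + g)"
        unfolding state_closed_loop[where T = T]
        using g(2) by (intro norm_state_le L)
          (auto intro!: norm_triangle_le add_mono free forced simp: g_def)
      show "norm (state F B x0 (\<lambda>s. w s - H *v tail w T (nat s)) (\<lambda>_. 0) T) \<le> L * (norm x0 + g)"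
        using g(2) by (intro norm_state_le L) (auto intro: order_trans[OF free g(1)])
    qed
  qed
  then show ?thesis by blast
qed

text \<open>The constant consists of the change of the policy's own terminal cost and of the change of the optimal
cost; the latter is multiplied by the competitive ratio. Both are 0 when the terminal weight is \<open>P\<close>.\<close>

lemma competitive_bound:
  fixes a :: "'i \<Rightarrow> real" and j :: "'i \<Rightarrow> int"
  assumes a: "\<And>i. 0 \<le> a i" and b: "0 \<le> b" and Qf: "psd Qf"
  shows "\<exists>C. (Qf = P \<longrightarrow> C = 0) \<and> (\<forall>T w u h.
     (\<forall>s. 0 \<le> s \<and> s < int T \<longrightarrow> norm (w s) \<le> r) \<longrightarrow>
     (\<forall>s. s < 0 \<or> int T \<le> s \<longrightarrow> w s = 0) \<longrightarrow>
     (\<forall>t<T. deviation x0 w T u t = G *v h t \<and>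
        norm (h t) \<le> (\<Sum>i\<in>I. a i * norm (w (int t + j i))) + b * norm (tail w T (t + m))) \<longrightarrow>
     cost A B Q R Qf x0 T w u
       \<le> ((spec_norm S * (1 + spec_norm F) * (\<Sum>i\<in>I. a i) + b)\<^sup>2 * spec_norm H / l + 1)
           * Opt A B Q R Qf x0 T w + C)"
proof -
  define \<rho> where "\<rho> = (spec_norm S * (1 + spec_norm F) * (\<Sum>i\<in>I. a i) + b)\<^sup>2 * spec_norm H / l + 1"
  have \<rho>: "0 \<le> \<rho>" using l_pos by (simp add: \<rho>_def spec_norm_nonneg)
  obtain X where X: "\<And>T w u h. \<forall>s. norm (w s) \<le> max r 0 \<Longrightarrow>
     \<forall>t<T. deviation x0 w T u t = G *v h t \<and>
        norm (h t) \<le> (\<Sum>i\<in>I. a i * norm (w (int t + j i))) + b * norm (tail w T (t + m)) \<Longrightarrow>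
     norm (state A B x0 w u T) \<le> X \<and>
     norm (state F B x0 (\<lambda>s. w s - H *v tail w T (nat s)) (\<lambda>_. 0) T) \<le> X"
    using bounded_trajectories[where a = a and b = b and r = "max r 0" and ?x0.0 = x0 and I = I and j = j and m = m, OF a b max.cobounded2]
    by blast
  define C1 where "C1 = (if Qf = P then 0 else X\<^sup>2 / l + spec_norm P * X\<^sup>2)"
  define C2 where "C2 = (if Qf = P then 0 else spec_norm Qf * X\<^sup>2)"
  have "cost A B Q R Qf x0 T w u \<le> \<rho> * Opt A B Q R Qf x0 T w + (\<rho> * C1 + C2)"
    if wr: "\<forall>s. 0 \<le> s \<and> s < int T \<longrightarrow> norm (w s) \<le> r"
      and w0: "\<forall>s. s < 0 \<or> int T \<le> s \<longrightarrow> w s = 0"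
      and dev: "\<forall>t<T. deviation x0 w T u t = G *v h t \<and>
        norm (h t) \<le> (\<Sum>i\<in>I. a i * norm (w (int t + j i))) + b * norm (tail w T (t + m))"
    for T w u h
  proof -
    (* Outside the horizon the disturbance is 0, which r bounds only if it is nonnegative. *)
    have "norm (w s) \<le> max r 0" for s
      using wr[rule_format, of s] w0[rule_format, of s] by (cases "0 \<le> s \<and> s < int T") auto
    then have X: "norm (state A B x0 w u T) \<le> X"
      "norm (state F B x0 (\<lambda>s. w s - H *v tail w T (nat s)) (\<lambda>_. 0) T) \<le> X"
      using X dev by blast+
    have w: "\<forall>s\<ge>int T. w s = 0" using w0 by blast
    have "offline_cost x0 w T - C1 \<le> Opt A B Q R Qf x0 T w"
      unfolding Opt_def
    proof (rule cINF_greatest)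
      fix v
      have "offline_cost x0 w T \<le> cost A B Q R P x0 T w v"
        by (simp add: cost_eq_offline_cost[OF w] sum_nonneg W_nonneg)
      then show "offline_cost x0 w T - C1 \<le> cost A B Q R Qf x0 T w v"
        using offline_cost_le_cost[OF w Qf X(2), of v] by (auto simp: C1_def)
    qed simp
    then have "\<rho> * offline_cost x0 w T \<le> \<rho> * (Opt A B Q R Qf x0 T w + C1)"
      using \<rho> by (intro mult_left_mono) simp_all
    moreover have "cost A B Q R P x0 T w u \<le> \<rho> * offline_cost x0 w T"
      unfolding \<rho>_def using dev by (intro cost_le_offline_cost[where j = j and m = m, OF w0 a b]) blast+
    moreover have "cost A B Q R Qf x0 T w u \<le> cost A B Q R P x0 T w u + C2"
    proof (cases "Qf = P")
      case False
      have "state A B x0 w u T \<bullet> (Qf *v state A B x0 w u T) \<le> spec_norm Qf * X\<^sup>2"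
        using X(1) by (intro order_trans[OF quadratic_form_le_spec_norm] mult_left_mono power_mono
            spec_norm_nonneg) simp_all
      then show ?thesis
        using False P_nonneg[of "state A B x0 w u T"]
        unfolding cost_terminal_change[of Qf] by (simp add: C2_def)
    qed (simp add: C2_def)
    ultimately show ?thesis by (simp add: distrib_left)
  qed
  moreover have "Qf = P \<longrightarrow> \<rho> * C1 + C2 = 0" by (simp add: C1_def C2_def)
  ultimately show ?thesis unfolding \<rho>_def by blast
qed

end

section \<open>The myopic policy\<close>

text \<open>The true state and the estimate follow the same linear dynamics with the same controls from the
same initial state, so their difference is driven by the errors of the disturbances used.\<close>

lemma state_estimate_error:
  "state A B x0 w u (t - d + j) - state_estimate A B d k what (state A B x0 w u) u t j
     = (\<Sum>i<j. matpow A (j - Suc i) *v (w (int (t - d + i))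
         - (if int (t - d + i) \<le> int t - int d + int k - 1 then what (int (t - d + i)) t else 0)))"
proof (induction j)
  case (Suc j)
  let ?e = "\<lambda>i. w (int (t - d + i))
         - (if int (t - d + i) \<le> int t - int d + int k - 1 then what (int (t - d + i)) t else 0)"
  have "A *v (\<Sum>i<j. matpow A (j - Suc i) *v ?e i) = (\<Sum>i<j. matpow A (Suc j - Suc i) *v ?e i)"
    unfolding matrix_vector_mult_sum
    by (intro sum.cong refl) (simp add: matrix_vector_mul_assoc Suc_diff_Suc
        flip: matpow.simps(2))
  with Suc show ?case
    by (simp add: Let_def matrix_vector_mult_diff_distrib algebra_simps)
qed simp

text \<open>When \<open>t < d\<close> the estimate starts from time 0 and accumulates only \<open>t\<close> errors. The missing ones
would have negative time index, where disturbances and predictions vanish, so they may be added; this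
gives one formula for all \<open>t\<close>, indexed by the distance \<open>i\<close> from time \<open>t - d\<close>.\<close>

lemma propagated_estimate_error:
  assumes "\<forall>s<0. w s = 0 \<and> what s t = 0"
  shows "A *v (state A B x0 w u t
      - state_estimate A B d k what (state A B x0 w u) u t (t - (t - d)))
     = (\<Sum>i<d. matpow A (d - i) *v (w (int t - int d + int i)
         - (if i < k then what (int t - int d + int i) t else 0)))"
proof -
  (* This is min d t, as the inner difference is truncated. *)
  define n where "n = t - (t - d)"
  let ?e = "\<lambda>s. w s - (if s \<le> int t - int d + int k - 1 then what s t else 0)"
  have "A *v (state A B x0 w u (t - d + n)
      - state_estimate A B d k what (state A B x0 w u) u t n)
     = (\<Sum>i<n. matpow A (n - i) *v ?e (int (t - d + i)))"
    unfolding state_estimate_error matrix_vector_mult_sum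
    by (intro sum.cong refl) (simp add: matrix_vector_mul_assoc Suc_diff_Suc
        flip: matpow.simps(2))
  also have "\<dots> = (\<Sum>i\<in>{d-n..<d}. matpow A (d - i) *v ?e (int t - int d + int i))"
    by (rule sum.reindex_bij_witness[where i = "\<lambda>i. i - (d - n)" and j = "\<lambda>i. i + (d - n)"])
      (auto simp: n_def of_nat_diff ac_simps)
  also have "\<dots> = (\<Sum>i<d. matpow A (d - i) *v ?e (int t - int d + int i))"
    by (rule sum.mono_neutral_left) (use assms in \<open>auto simp: n_def\<close>)
  also have "\<dots> = (\<Sum>i<d. matpow A (d - i) *v (w (int t - int d + int i)
         - (if i < k then what (int t - int d + int i) t else 0)))"
    by (intro sum.cong refl) auto
  finally have "A *v (state A B x0 w u (t - d + n)
      - state_estimate A B d k what (state A B x0 w u) u t n)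
    = (\<Sum>i<d. matpow A (d - i) *v (w (int t - int d + int i)
         - (if i < k then what (int t - int d + int i) t else 0)))" .
  moreover have "t - d + n = t" by (simp add: n_def)
  ultimately show ?thesis unfolding n_def by metis
qed

text \<open>The factor with which the disturbance at time \<open>t - d + i\<close> enters the deviation at time \<open>t\<close>. A
disturbance that lies in the past (\<open>i < d\<close>) but is not predicted (\<open>k \<le> i\<close>) is replaced by 0 in the
estimate and contributes with relative error 1.\<close>

definition (in regulator) weight :: "(nat \<Rightarrow> real) \<Rightarrow> nat \<Rightarrow> nat \<Rightarrow> nat \<Rightarrow> real" where
  "weight \<epsilon> d k i = spec_norm P *
     (if i < d then (if i < k then \<epsilon> i else 1) * spec_norm (matpow A (d - i))
      else \<epsilon> i * spec_norm (matpow F (i - d)))"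

text \<open>With truncated subtraction this covers both forms of the policy: if \<open>k \<le> d\<close>, then \<open>k - d = 0\<close>, the
sum over predictions of future disturbances is empty and the whole tail is unknown.\<close>

lemma (in regulator) myopic_deviation:
  fixes w what T d k x0
  defines "u \<equiv> myopic_policy A B R P x0 d k w what"
  assumes adm: "admissible r \<epsilon> d T w what"
  shows "\<exists>h. deviation x0 w T u t = G *v h
     \<and> norm h \<le> (\<Sum>i<max d k. weight \<epsilon> d k i * norm (w (int t + (int i - int d))))
         + spec_norm (matpow F (k - d)) * norm (tail w T (t + (k - d)))"
proof -
  define x where "x = state A B x0 w u"
  define xhat where "xhat = state_estimate A B d k what x u t (t - (t - d))"
  define old where "old = (\<lambda>i. w (int t - int d + int i)
         - (if i < k then what (int t - int d + int i) t else 0))"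
  define new where "new = (\<lambda>i. w (int t + int i) - what (int t + int i) t)"
  define n where "n = k - d"
  (* The three parts are the error of the state estimate, the errors of the predictions of
     future disturbances, and the tail beyond the prediction window. *)
  let ?h1 = "P *v (\<Sum>i<d. matpow A (d - i) *v old i)"
  let ?h2 = "\<Sum>i<n. matpow (transpose F) i *v (P *v new i)"
  let ?h3 = "matpow (transpose F) n *v tail w T (t + n)"
  have zero: "\<forall>s. s < 0 \<or> int T \<le> s \<longrightarrow> w s = 0 \<and> what s t = 0"
    and err: "\<And>i. norm (w (int t - int d + int i) - what (int t - int d + int i) t)
              \<le> \<epsilon> i * norm (w (int t - int d + int i))"
    using adm unfolding admissible_def by blast+
  have "u t = myopic_control A B R P x0 d k w what u t"
    unfolding u_def by (rule myopic_policy_eq)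
  also have "\<dots> = - (G *v (P *v (A *v xhat)
      + (\<Sum>i<n. matpow (transpose F) i *v (P *v what (int t + int i) t))))"
    unfolding myopic_control_def Let_def G_eq[symmetric] F_eq[symmetric] x_def[symmetric]
      xhat_def[symmetric] n_def[symmetric]
    by (simp add: n_def)
  finally have "u t = - (G *v (P *v (A *v xhat)
      + (\<Sum>i<n. matpow (transpose F) i *v (P *v what (int t + int i) t))))" .
  moreover have "P *v (A *v x t) = P *v (A *v xhat) + ?h1"
  proof -
    have "A *v (x t - xhat) = (\<Sum>i<d. matpow A (d - i) *v old i)"
      unfolding x_def xhat_def old_def using zero by (intro propagated_estimate_error) simp
    then have "P *v (A *v x t - A *v xhat) = ?h1"
      by (simp only: matrix_vector_mult_diff_distrib)
    then show ?thesis
      unfolding matrix_vector_mult_diff_distrib[of P] by (simp add: diff_eq_eq add.commute)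
  qed
  moreover have "tail w T t
      = (\<Sum>i<n. matpow (transpose F) i *v (P *v what (int t + int i) t)) + (?h2 + ?h3)"
  proof -
    have "(\<Sum>i<n. matpow (transpose F) i *v (P *v w (int t + int i)))
        = (\<Sum>i<n. matpow (transpose F) i *v (P *v what (int t + int i) t)) + ?h2"
      unfolding sum.distrib[symmetric]
      by (simp add: new_def flip: matrix_vector_right_distrib)
    then show ?thesis using tail_unroll[of T w t n] zero by (simp add: add.assoc)
  qed
  ultimately have "deviation x0 w T u t = G *v (?h1 + (?h2 + ?h3))"
    unfolding deviation_def x_def[symmetric] by (simp only: matrix_vector_right_distrib) simp
  moreover have "norm ?h1 \<le> (\<Sum>i<d. weight \<epsilon> d k i * norm (w (int t + (int i - int d))))"
    unfolding matrix_vector_mult_sum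
  proof (rule sum_norm_le)
    fix i assume i: "i \<in> {..<d}"
    have "norm (old i) \<le> (if i < k then \<epsilon> i else 1) * norm (w (int t - int d + int i))"
      using err[of i] by (simp add: old_def)
    then have "norm (P *v (matpow A (d - i) *v old i)) \<le> spec_norm P * (spec_norm (matpow A (d - i))
        * ((if i < k then \<epsilon> i else 1) * norm (w (int t - int d + int i))))"
      by (intro order_trans[OF norm_matrix_vector_le] mult_left_mono spec_norm_nonneg)
    then show "norm (P *v (matpow A (d - i) *v old i))
        \<le> weight \<epsilon> d k i * norm (w (int t + (int i - int d)))"
      using i by (simp add: weight_def algebra_simps)
  qed
  moreover have "norm ?h2 \<le> (\<Sum>i\<in>{d..<max d k}. weight \<epsilon> d k i * norm (w (int t + (int i - int d))))"
  proof -
    have "norm ?h2 \<le> (\<Sum>i<n. weight \<epsilon> d k (i + d) * norm (w (int t + int i)))"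
    proof (rule sum_norm_le)
      fix i
      have "norm (matpow (transpose F) i *v (P *v new i)) \<le> spec_norm (matpow (transpose F) i)
          * (spec_norm P * (\<epsilon> (i + d) * norm (w (int t + int i))))"
        using err[of "i + d"]
        by (intro order_trans[OF norm_matrix_vector_le] mult_left_mono spec_norm_nonneg)
          (simp add: new_def)
      then show "norm (matpow (transpose F) i *v (P *v new i))
          \<le> weight \<epsilon> d k (i + d) * norm (w (int t + int i))"
        by (simp add: weight_def transpose_matpow spec_norm_transpose mult_ac)
    qed
    also have "\<dots> = (\<Sum>i\<in>{d..<max d k}. weight \<epsilon> d k i * norm (w (int t + (int i - int d))))"
      by (rule sum.reindex_bij_witness[where i = "\<lambda>i. i - d" and j = "\<lambda>i. i + d"])
        (auto simp: n_def)
    finally show ?thesis .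
  qed
  moreover have "norm ?h3 \<le> spec_norm (matpow F n) * norm (tail w T (t + n))"
    using norm_matrix_vector_le[of "matpow (transpose F) n"]
    by (simp add: transpose_matpow spec_norm_transpose)
  moreover have "(\<Sum>i<max d k. weight \<epsilon> d k i * norm (w (int t + (int i - int d))))
      = (\<Sum>i<d. weight \<epsilon> d k i * norm (w (int t + (int i - int d))))
        + (\<Sum>i\<in>{d..<max d k}. weight \<epsilon> d k i * norm (w (int t + (int i - int d))))"
    unfolding lessThan_atLeast0 by (rule sum.atLeastLessThan_concat[symmetric]) simp_all
  moreover have "norm (?h1 + (?h2 + ?h3)) \<le> norm ?h1 + (norm ?h2 + norm ?h3)"
    by (intro order_trans[OF norm_triangle_ineq] add_left_mono norm_triangle_ineq)
  ultimately show ?thesis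
    unfolding n_def[symmetric] by (intro exI[of _ "?h1 + (?h2 + ?h3)"] conjI) linarith+
qed

theorem theorem4:
  fixes A Q Qf P F H :: "real^'n^'n"
    and B :: "real^'m^'n"
    and R :: "real^'m^'m"
    and x0 :: "real^'n"
    and r c :: real
    and \<epsilon> :: "nat \<Rightarrow> real"
    and d k :: nat
  assumes "psd Q" and "psd Qf" and "pos_def R"
    and "stabilizable A B" and "stabilizable (transpose A) Q"
    and "psd P" and "riccati_solution A B Q R P"
    and "F = closed_loop A B R P"
    and "H = B ** gain B R P"
    and "c = spec_norm P * spec_norm (matrix_inv P) * (1 + spec_norm F)"
    and "invertible P"
    and "lambda_min (matrix_inv P - F ** matrix_inv P ** transpose F - H) > 0"
    and "\<And>i. 0 \<le> \<epsilon> i"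
  shows "(d \<le> k \<longrightarrow>
      (\<exists>C. (Qf = P \<longrightarrow> C = 0) \<and>
        (\<forall>T w what. admissible r \<epsilon> d T w what \<longrightarrow>
          Alg A B Q R Qf P x0 d k T w what
            \<le> ((c * (\<Sum>i<d. \<epsilon> i * spec_norm (matpow A (d - i)))
                 + c * (\<Sum>i\<in>{d..<k}. \<epsilon> i * spec_norm (matpow F (i - d)))
                 + spec_norm (matpow F (k - d)))\<^sup>2
               / (inverse (spec_norm H)
                  * lambda_min (matrix_inv P - F ** matrix_inv P ** transpose F - H))
               + 1) * Opt A B Q R Qf x0 T w + C)))
    \<and> (k \<le> d \<longrightarrow>
      (\<exists>C. (Qf = P \<longrightarrow> C = 0) \<and>
        (\<forall>T w what. admissible r \<epsilon> d T w what \<longrightarrow>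
          Alg A B Q R Qf P x0 d k T w what
            \<le> ((c * (\<Sum>i<k. \<epsilon> i * spec_norm (matpow A (d - i)))
                 + c * (\<Sum>i\<in>{k..<d}. spec_norm (matpow A (d - i)))
                 + 1)\<^sup>2
               / (inverse (spec_norm H)
                  * lambda_min (matrix_inv P - F ** matrix_inv P ** transpose F - H))
               + 1) * Opt A B Q R Qf x0 T w + C)))"
proof -
  define l where "l = lambda_min (matrix_inv P - F ** matrix_inv P ** transpose F - H)"
  interpret regulator A Q P F H "matrix_inv P" "matrix_inv P - F ** matrix_inv P ** transpose F - H"
      B "gain B R P" R "R + transpose B ** P ** B" l
    by unfold_locales (use assms in \<open>simp_all add: l_def\<close>)
  have weight_nonneg: "0 \<le> weight \<epsilon> d k i" for i
    using assms(13) by (simp add: weight_def spec_norm_nonneg)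
  define \<kappa> where "\<kappa> = spec_norm (matrix_inv P) * (1 + spec_norm F) * (\<Sum>i<max d k. weight \<epsilon> d k i)
      + spec_norm (matpow F (k - d))"
  have "\<exists>C. (Qf = P \<longrightarrow> C = 0) \<and> (\<forall>T w u h.
     (\<forall>s. 0 \<le> s \<and> s < int T \<longrightarrow> norm (w s) \<le> r) \<longrightarrow>
     (\<forall>s. s < 0 \<or> int T \<le> s \<longrightarrow> w s = 0) \<longrightarrow>
     (\<forall>t<T. deviation x0 w T u t = gain B R P *v h t \<and>
        norm (h t) \<le> (\<Sum>i<max d k. weight \<epsilon> d k i * norm (w (int t + (int i - int d))))
          + spec_norm (matpow F (k - d)) * norm (tail w T (t + (k - d)))) \<longrightarrow>
     cost A B Q R Qf x0 T w u \<le> (\<kappa>\<^sup>2 * spec_norm H / l + 1) * Opt A B Q R Qf x0 T w + C)"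
    unfolding \<kappa>_def
    by (rule competitive_bound[where a = "weight \<epsilon> d k" and b = "spec_norm (matpow F (k - d))"
        and r = r and ?x0.0 = x0 and I = "{..<max d k}" and j = "\<lambda>i. int i - int d" and m = "k - d",
        OF weight_nonneg spec_norm_nonneg assms(2)])
  then obtain C where C: "Qf = P \<longrightarrow> C = 0"
    and bound: "\<forall>T w u h. (\<forall>s. 0 \<le> s \<and> s < int T \<longrightarrow> norm (w s) \<le> r) \<longrightarrow>
     (\<forall>s. s < 0 \<or> int T \<le> s \<longrightarrow> w s = 0) \<longrightarrow>
     (\<forall>t<T. deviation x0 w T u t = gain B R P *v h t \<and>
        norm (h t) \<le> (\<Sum>i<max d k. weight \<epsilon> d k i * norm (w (int t + (int i - int d))))
          + spec_norm (matpow F (k - d)) * norm (tail w T (t + (k - d)))) \<longrightarrow>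
     cost A B Q R Qf x0 T w u \<le> (\<kappa>\<^sup>2 * spec_norm H / l + 1) * Opt A B Q R Qf x0 T w + C"
    by (elim exE conjE) (rule that)
  have Alg: "Alg A B Q R Qf P x0 d k T w what
      \<le> (\<kappa>\<^sup>2 / (inverse (spec_norm H) * l) + 1) * Opt A B Q R Qf x0 T w + C"
    if adm: "admissible r \<epsilon> d T w what" for T w what
  proof -
    have "\<forall>t. \<exists>h. deviation x0 w T (myopic_policy A B R P x0 d k w what) t = gain B R P *v h \<and>
        norm h \<le> (\<Sum>i<max d k. weight \<epsilon> d k i * norm (w (int t + (int i - int d))))
          + spec_norm (matpow F (k - d)) * norm (tail w T (t + (k - d)))"
      by (intro allI myopic_deviation[OF adm])
    from choice[OF this] obtain h where h: "\<forall>t.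
        deviation x0 w T (myopic_policy A B R P x0 d k w what) t = gain B R P *v h t \<and>
        norm (h t) \<le> (\<Sum>i<max d k. weight \<epsilon> d k i * norm (w (int t + (int i - int d))))
          + spec_norm (matpow F (k - d)) * norm (tail w T (t + (k - d)))" ..
    have "\<forall>s. 0 \<le> s \<and> s < int T \<longrightarrow> norm (w s) \<le> r" and "\<forall>s. s < 0 \<or> int T \<le> s \<longrightarrow> w s = 0"
      using adm unfolding admissible_def by blast+
    note bound = bound[THEN spec, THEN spec, THEN spec, THEN spec, THEN mp, OF this(1), THEN mp,
        OF this(2), THEN mp]
    have "Alg A B Q R Qf P x0 d k T w what
        \<le> (\<kappa>\<^sup>2 * spec_norm H / l + 1) * Opt A B Q R Qf x0 T w + C"
      unfolding Alg_def
      by (rule bound, intro allI impI, rule h[THEN spec])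
    (* Both sides also agree when the norm of H is 0, as then its inverse is 0 and so is the quotient. *)
    then show ?thesis by (simp add: divide_inverse mult.assoc)
  qed
  have far: "\<kappa> = c * (\<Sum>i<d. \<epsilon> i * spec_norm (matpow A (d - i)))
                 + c * (\<Sum>i\<in>{d..<k}. \<epsilon> i * spec_norm (matpow F (i - d)))
                 + spec_norm (matpow F (k - d))" if "d \<le> k"
  proof -
    have "(\<Sum>i<max d k. weight \<epsilon> d k i)
        = (\<Sum>i<d. weight \<epsilon> d k i) + (\<Sum>i\<in>{d..<k}. weight \<epsilon> d k i)"
      unfolding lessThan_atLeast0 using that by (simp add: sum.atLeastLessThan_concat max_def)
    also have "(\<Sum>i<d. weight \<epsilon> d k i) = spec_norm P * (\<Sum>i<d. \<epsilon> i * spec_norm (matpow A (d - i)))"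
      unfolding sum_distrib_left using that by (intro sum.cong) (auto simp: weight_def)
    also have "(\<Sum>i\<in>{d..<k}. weight \<epsilon> d k i)
        = spec_norm P * (\<Sum>i\<in>{d..<k}. \<epsilon> i * spec_norm (matpow F (i - d)))"
      unfolding sum_distrib_left by (intro sum.cong) (auto simp: weight_def)
    finally show ?thesis by (simp add: \<kappa>_def assms(10) algebra_simps)
  qed
  have near: "\<kappa> = c * (\<Sum>i<k. \<epsilon> i * spec_norm (matpow A (d - i)))
                 + c * (\<Sum>i\<in>{k..<d}. spec_norm (matpow A (d - i))) + 1" if "k \<le> d"
  proof -
    have "(\<Sum>i<max d k. weight \<epsilon> d k i)
        = (\<Sum>i<k. weight \<epsilon> d k i) + (\<Sum>i\<in>{k..<d}. weight \<epsilon> d k i)"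
      unfolding lessThan_atLeast0 using that by (simp add: sum.atLeastLessThan_concat max_def)
    also have "(\<Sum>i<k. weight \<epsilon> d k i) = spec_norm P * (\<Sum>i<k. \<epsilon> i * spec_norm (matpow A (d - i)))"
      unfolding sum_distrib_left using that by (intro sum.cong) (auto simp: weight_def)
    also have "(\<Sum>i\<in>{k..<d}. weight \<epsilon> d k i)
        = spec_norm P * (\<Sum>i\<in>{k..<d}. spec_norm (matpow A (d - i)))"
      unfolding sum_distrib_left by (intro sum.cong) (auto simp: weight_def)
    moreover have "spec_norm (matpow F (k - d)) = 1"
      using that by (simp add: spec_norm_def onorm_id)
    ultimately show ?thesis by (simp add: \<kappa>_def assms(10) algebra_simps)
  qed
  show ?thesis
    unfolding l_def[symmetric]
  proof (intro conjI impI)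
    assume "d \<le> k"
    from far[OF this, symmetric] show "\<exists>C. (Qf = P \<longrightarrow> C = 0) \<and> (\<forall>T w what.
        admissible r \<epsilon> d T w what \<longrightarrow> Alg A B Q R Qf P x0 d k T w what
          \<le> ((c * (\<Sum>i<d. \<epsilon> i * spec_norm (matpow A (d - i)))
                 + c * (\<Sum>i\<in>{d..<k}. \<epsilon> i * spec_norm (matpow F (i - d)))
                 + spec_norm (matpow F (k - d)))\<^sup>2 / (inverse (spec_norm H) * l) + 1)
              * Opt A B Q R Qf x0 T w + C)"
      using C Alg by (intro exI[of _ C]) simp
  next
    assume "k \<le> d"
    from near[OF this, symmetric] show "\<exists>C. (Qf = P \<longrightarrow> C = 0) \<and> (\<forall>T w what.
        admissible r \<epsilon> d T w what \<longrightarrow> Alg A B Q R Qf P x0 d k T w what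
          \<le> ((c * (\<Sum>i<k. \<epsilon> i * spec_norm (matpow A (d - i)))
                 + c * (\<Sum>i\<in>{k..<d}. spec_norm (matpow A (d - i)))
                 + 1)\<^sup>2 / (inverse (spec_norm H) * l) + 1)
              * Opt A B Q R Qf x0 T w + C)"
      using C Alg by (intro exI[of _ C]) simp
  qed
qed

end
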